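(* Let $n\in\mathbb N$ and let $A$ be a real $n\times n$ matrix that is diagonalizable over $\mathbb R$ with positive eigenvalues. Let $H:\mathbb R^n\to\mathbb R$ be positively homogeneous of degree $\alpha>0$, have property (HC) on the unit sphere $\{x\in\mathbb R^n:|x|=1\}$, and satisfy $H(x)>0$ for all $|x|=1$. Let $t_*\ge 0$ and let $G:[t_*,\infty)\times\mathbb R^n\to\mathbb R^n$ be continuous, and suppose there are numbers $T_*\ge t_*$ and $c_*,r_*,\delta>0$ such that $|G(t,x)|\le c_*|x|^{1+\alpha+\delta}$ for all $t\ge T_*$ and all $x\in\mathbb R^n$ with $|x|\le r_*$. Let $y\in C^1([t_*,\infty),\mathbb R^n)$ satisfy $$y'=-H(y)Ay+G(t,y)\quad\text{on }(t_*,\infty),$$ $y(t)\ne 0$ for all $t\ge t_*$, and $\lim_{t\to\infty}y(t)=0$. Then there exist an eigenvalue $\Lambda$ of $A$ and an eigenvector $\xi_*$ of $A$ associated with $\Lambda$ such that, as $t\to\infty$, $$|y(t)-\xi_* t^{-1/\alpha}|=\mathcal O(t^{-1/\alpha-\varepsilon})\quad\text{for some }\varepsilon>0.$$ More specifically, as $t\to\infty$, both $$|(I_n-R_\Lambda)y(t)|=\mathcal O(t^{-1/\alpha-\varepsilon})\quad\text{and}\quad |R_\Lambda y(t)-\xi_* t^{-1/\alpha}|=\mathcal O(t^{-1/\alpha-\varepsilon})\quad\text{for some }\varepsilon>0,$$ and $$\alpha\Lambda H(\xi_* )=1.$$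
   Context: $|\cdot|$ is the Euclidean norm on $\mathbb R^n$; $I_n$ is the identity matrix. For nonnegative functions $f,g$ defined for large $t$, $f(t)=\mathcal O(g(t))$ as $t\to\infty$ means there are $T'$ and $C>0$ with $f(t)\le Cg(t)$ for all $t\ge T'$. A function $F:\mathbb R^n\to\mathbb R$ is positively homogeneous of degree $\beta>0$ if $F(tx)=t^\beta F(x)$ for all $x\in\mathbb R^n$ and $t>0$. Property (HC): for a nonempty set $E\subset\mathbb R^n$, a function $F:E\to\mathbb R$ (or the restriction to $E$ of a function on a larger set) has property (HC) on $E$ if for every $x_0\in E$ there exist $r,C,\gamma>0$ (which may depend on $x_0$) such that $|F(x)-F(x_0)|\le C|x-x_0|^\gamma$ for all $x\in E$ with $|x-x_0|<r$. Projections: write $A=S^{-1}A_0S$ with $S$ a real invertible matrix and $A_0=\mathrm{diag}[\Lambda_1,\dots,\Lambda_n]$, where $0<\Lambda_1\le\dots\le\Lambda_n$. For an eigenvalue $\lambda$ of $A$, $R_\lambda=S^{-1}\hat R_\lambda S$, where $\hat R_\lambda$ is the diagonal matrix with $i$-th diagonal entry $1$ if $\Lambda_i=\lambda$ and $0$ otherwise. Thus $R_\lambda$ is the projection onto the eigenspace of $A$ for $\lambda$ along the sum of the other eigenspaces. *)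

theory Defs
  imports "HOL-Analysis.Analysis" "HOL-Library.Landau_Symbols"
begin

definition pos_homogeneous :: "real \<Rightarrow> (real ^ 'n \<Rightarrow> real) \<Rightarrow> bool" where
  "pos_homogeneous \<beta> F \<longleftrightarrow> (\<forall>x. \<forall>t>0. F (t *\<^sub>R x) = t powr \<beta> * F x)"

definition property_HC :: "(real ^ 'n) set \<Rightarrow> (real ^ 'n \<Rightarrow> real) \<Rightarrow> bool" where
  "property_HC E F \<longleftrightarrow>
     (\<forall>x\<^sub>0\<in>E. \<exists>r>0. \<exists>C>0. \<exists>\<gamma>>0. \<forall>x\<in>E. norm (x - x\<^sub>0) < r \<longrightarrow>
        \<bar>F x - F x\<^sub>0\<bar> \<le> C * norm (x - x\<^sub>0) powr \<gamma>)"

definition eigenvector :: "real ^ 'n ^ 'n \<Rightarrow> real ^ 'n \<Rightarrow> real \<Rightarrow> bool" where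
  "eigenvector A v \<mu> \<longleftrightarrow> v \<noteq> 0 \<and> A *v v = \<mu> *\<^sub>R v"

definition eigenvalue :: "real ^ 'n ^ 'n \<Rightarrow> real \<Rightarrow> bool" where
  "eigenvalue A \<mu> \<longleftrightarrow> (\<exists>v. eigenvector A v \<mu>)"

definition diag_matrix :: "real ^ 'n \<Rightarrow> real ^ 'n ^ 'n" where
  "diag_matrix d = (\<chi> i j. if i = j then d $ i else 0)"

(* The index type carries no order, so the diagonal entries d are not listed
   increasingly; neither A nor the projections below depend on their order. *)
definition diagonalized_by :: "real ^ 'n ^ 'n \<Rightarrow> real ^ 'n ^ 'n \<Rightarrow> real ^ 'n \<Rightarrow> bool" where
  "diagonalized_by A S d \<longleftrightarrow> invertible S \<and> A = matrix_inv S ** diag_matrix d ** S"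

(* For A diagonalized by S and d: the projection onto the eigenspace of A for \<mu>
   along the sum of the other eigenspaces. *)
definition eigenprojection :: "real ^ 'n ^ 'n \<Rightarrow> real ^ 'n \<Rightarrow> real \<Rightarrow> real ^ 'n ^ 'n" where
  "eigenprojection S d \<mu> =
     matrix_inv S ** diag_matrix (\<chi> i. if d $ i = \<mu> then 1 else 0) ** S"

end

theory Submission
  imports Defs
begin

text \<open>
  Let \<open>\<phi>\<close> be an antiderivative of \<open>H (y t)\<close> and pass to the coordinates \<open>z = S y\<close>, so that
  \<open>exp (d\<^sub>i \<phi>) z\<^sub>i\<close> changes only through the perturbation. In terms of \<open>\<phi>\<close> the norm of \<open>z\<close> lies between two
  decaying exponentials; let \<open>\<Lambda>\<close> be the supremum of the exponents \<open>\<sigma>\<close> with \<open>z = O(exp (- \<sigma> \<phi>))\<close>.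
  Since the perturbation is of higher order, it is \<open>O(\<phi>' exp (- p \<phi>))\<close> for some \<open>p > \<Lambda>\<close>, and integrating
  coordinatewise gives \<open>z = exp (- \<Lambda> \<phi>) \<omega> + O(exp (- p \<phi>))\<close> with \<open>\<omega>\<close> supported on \<open>d\<^sub>i = \<Lambda>\<close>; by the
  choice of \<open>\<Lambda>\<close> as a supremum, \<open>\<omega>\<close> is nonzero and \<open>\<Lambda>\<close> is an eigenvalue. Finally, by homogeneity and
  Hoelder continuity of \<open>H\<close>, the derivative of \<open>exp (\<alpha> \<Lambda> \<phi>)\<close> converges to a positive constant at an
  exponential rate in \<open>\<phi>\<close>, which yields \<open>exp (- \<Lambda> \<phi>)\<close> as a multiple of \<open>t powr (- 1 / \<alpha>)\<close> up to a relative
  error \<open>O(t powr (- \<epsilon>))\<close>.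
\<close>

subsection \<open>Expansion in terms of the phase\<close>

text \<open>Both \<open>B - f\<close> and \<open>B + f\<close> have nonnegative derivatives, hence
  are nondecreasing. This comparison stands in for integrating \<open>f'\<close>, so no
  integrability of \<open>f'\<close> has to be assumed.\<close>

lemma abs_increment_le:
  fixes f B :: "real \<Rightarrow> real"
  assumes f: "\<And>t. t \<ge> T \<Longrightarrow> (f has_real_derivative f' t) (at t)"
    and B: "\<And>t. t \<ge> T \<Longrightarrow> (B has_real_derivative B' t) (at t)"
    and le: "\<And>t. t \<ge> T \<Longrightarrow> \<bar>f' t\<bar> \<le> B' t"
    and st: "T \<le> s" "s \<le> t"
  shows "\<bar>f t - f s\<bar> \<le> B t - B s"
proof -
  have "B s - f s \<le> B t - f t"
  proof (rule DERIV_nonneg_imp_nondecreasing[OF st(2)])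
    fix x assume "s \<le> x" "x \<le> t"
    then have "((\<lambda>x. B x - f x) has_real_derivative B' x - f' x) (at x)" "B' x - f' x \<ge> 0"
      using st le[of x] by (auto intro!: DERIV_diff f B)
    then show "\<exists>y. ((\<lambda>x. B x - f x) has_real_derivative y) (at x) \<and> 0 \<le> y" by blast
  qed
  moreover have "B s + f s \<le> B t + f t"
  proof (rule DERIV_nonneg_imp_nondecreasing[OF st(2)])
    fix x assume "s \<le> x" "x \<le> t"
    then have "((\<lambda>x. B x + f x) has_real_derivative B' x + f' x) (at x)" "B' x + f' x \<ge> 0"
      using st le[of x] by (auto intro!: DERIV_add f B)
    then show "\<exists>y. ((\<lambda>x. B x + f x) has_real_derivative y) (at x) \<and> 0 \<le> y" by blast
  qed
  ultimately show ?thesis by linarith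
qed

text \<open>The increment bound makes \<open>f + B\<close> nondecreasing and \<open>f - B\<close>
  nonincreasing. As \<open>B\<close> is nonpositive, every value of the first lies below every value
  of the second, and the supremum of \<open>f + B\<close> separates them. When \<open>B\<close>
  tends to 0, \<open>L\<close> is the limit of \<open>f\<close>, with an explicit rate.\<close>

lemma limit_of_bounded_increments:
  fixes f B :: "real \<Rightarrow> real"
  assumes inc: "\<And>s t. T \<le> s \<Longrightarrow> s \<le> t \<Longrightarrow> \<bar>f t - f s\<bar> \<le> B t - B s"
    and B: "\<And>t. t \<ge> T \<Longrightarrow> B t \<le> 0"
  shows "\<exists>L. \<forall>t\<ge>T. \<bar>f t - L\<bar> \<le> - B t"
proof -
  let ?X = "(\<lambda>s. f s + B s) ` {T..}"
  have ub: "f t + B t \<le> f s - B s" if "T \<le> s" "T \<le> t" for s t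
    using inc[of s t] inc[of t s] B[of s] B[of t] that by linarith
  have bdd: "bdd_above ?X"
    by (intro bdd_aboveI[of _ "f T - B T"]) (use ub[of T] in auto)
  have "f s + B s \<le> Sup ?X" "Sup ?X \<le> f s - B s" if "T \<le> s" for s
  proof -
    show "f s + B s \<le> Sup ?X" by (rule cSup_upper[OF _ bdd]) (use that in auto)
    show "Sup ?X \<le> f s - B s" by (rule cSup_least) (use that ub in auto)
  qed
  then show ?thesis by (intro exI[of _ "Sup ?X"]) (force simp: abs_le_iff)
qed

text \<open>Chooses the error exponent in \<open>phase_expansion\<close>: just above \<Lambda> and
  below every larger entry of \<open>d\<close>, so that it coincides with no entry and resonance is
  excluded.\<close>

lemma finite_gap_above:
  fixes X :: "real set"
  assumes "finite X" "a < b"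
  shows "\<exists>p. a < p \<and> p < b \<and> (\<forall>x\<in>X. a < x \<longrightarrow> p < x)"
  using assms
proof (induction X)
  case empty
  then show ?case using dense by auto
next
  case (insert x X)
  then obtain p where p: "a < p" "p < b" "\<forall>x\<in>X. a < x \<longrightarrow> p < x" by auto
  show ?case
  proof (cases "a < x")
    case True
    then obtain p' where "a < p'" "p' < min p x" using p dense[of a "min p x"] by auto
    then show ?thesis using p by (intro exI[of _ p']) force
  qed (use p in auto)
qed

text \<open>Variation of constants: \<open>exp (\<mu> * \<phi>) * x\<close> has derivative
  \<open>exp (\<mu> * \<phi>) * g\<close>, which is dominated by the derivative of \<open>B\<close>.
  For \<open>p < \<mu>\<close> the free solution decays faster than the error and is absorbed by it;
  for \<open>p > \<mu>\<close> the function \<open>B\<close> is nonpositive and the previous lemma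
  yields the coefficient. Equality would produce an extra factor \<phi>.\<close>

lemma coordinate_expansion:
  fixes \<phi> q x g :: "real \<Rightarrow> real"
  assumes \<phi>: "\<And>t. t \<ge> T \<Longrightarrow> (\<phi> has_real_derivative q t) (at t)"
    and \<phi>0: "\<And>t. t \<ge> T \<Longrightarrow> \<phi> t \<ge> 0"
    and x: "\<And>t. t \<ge> T \<Longrightarrow> (x has_real_derivative - q t * \<mu> * x t + g t) (at t)"
    and g: "\<And>t. t \<ge> T \<Longrightarrow> \<bar>g t\<bar> \<le> C * q t * exp (- p * \<phi> t)"
    and q: "\<And>t. t \<ge> T \<Longrightarrow> q t \<ge> 0"
    and C: "C \<ge> 0" and p: "p \<noteq> \<mu>"
  shows "\<exists>\<omega> K. (p < \<mu> \<longrightarrow> \<omega> = 0) \<and> (\<forall>t\<ge>T. \<bar>x t - exp (- \<mu> * \<phi> t) * \<omega>\<bar> \<le> K * exp (- p * \<phi> t))"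
proof -
  define w where "w = (\<lambda>t. exp (\<mu> * \<phi> t) * x t)"
  define B where "B = (\<lambda>t. C / (\<mu> - p) * exp ((\<mu> - p) * \<phi> t))"
  have inc: "\<bar>w t - w s\<bar> \<le> B t - B s" if "T \<le> s" "s \<le> t" for s t
  proof (rule abs_increment_le[OF _ _ _ that])
    fix t assume t: "T \<le> t"
    show "(w has_real_derivative exp (\<mu> * \<phi> t) * g t) (at t)"
      unfolding w_def by (rule derivative_eq_intros \<phi> x t refl)+ (simp add: algebra_simps)
    show "(B has_real_derivative C * q t * exp ((\<mu> - p) * \<phi> t)) (at t)"
      unfolding B_def by (rule derivative_eq_intros \<phi> x t refl)+ (use p in \<open>simp add: field_simps\<close>)
    have "\<bar>exp (\<mu> * \<phi> t) * g t\<bar> \<le> exp (\<mu> * \<phi> t) * (C * q t * exp (- p * \<phi> t))"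
      using g[OF t] by (simp add: abs_mult)
    also have "\<dots> = C * q t * exp ((\<mu> - p) * \<phi> t)"
      by (simp add: algebra_simps flip: exp_add)
    finally show "\<bar>exp (\<mu> * \<phi> t) * g t\<bar> \<le> C * q t * exp ((\<mu> - p) * \<phi> t)" .
  qed
  have xw: "x t = exp (- \<mu> * \<phi> t) * w t" for t
    by (simp add: w_def flip: exp_add mult.assoc)
  have eB: "exp (- \<mu> * \<phi> t) * B t = C / (\<mu> - p) * exp (- p * \<phi> t)" for t
    by (simp add: B_def algebra_simps flip: exp_add)
  show ?thesis
  proof (cases "p < \<mu>")
    case True
    have "\<bar>x t\<bar> \<le> (\<bar>w T\<bar> + C / (\<mu> - p)) * exp (- p * \<phi> t)" if t: "T \<le> t" for t
    proof -
      have "B T \<ge> 0" using True C by (simp add: B_def)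
      then have "\<bar>w t\<bar> \<le> \<bar>w T\<bar> + B t" using inc[of T t] t by linarith
      then have "\<bar>x t\<bar> \<le> exp (- \<mu> * \<phi> t) * (\<bar>w T\<bar> + B t)"
        by (simp add: xw abs_mult)
      also have "\<dots> = \<bar>w T\<bar> * exp (- \<mu> * \<phi> t) + C / (\<mu> - p) * exp (- p * \<phi> t)"
        using eB[of t] by (simp add: algebra_simps)
      \<comment> \<open>Here \<phi> being nonnegative lets the larger exponent \<mu> be weakened to
        \<open>p\<close>.\<close>
      also have "\<dots> \<le> \<bar>w T\<bar> * exp (- p * \<phi> t) + C / (\<mu> - p) * exp (- p * \<phi> t)"
        using True \<phi>0[OF t] by (intro add_right_mono mult_left_mono) (auto intro: mult_right_mono)
      finally show ?thesis by (simp add: algebra_simps)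
    qed
    then show ?thesis by (intro exI[of _ 0] exI[of _ "\<bar>w T\<bar> + C / (\<mu> - p)"]) auto
  next
    case False
    have "\<exists>L. \<forall>t\<ge>T. \<bar>w t - L\<bar> \<le> - B t"
      using False p C by (intro limit_of_bounded_increments inc) (auto simp: B_def divide_simps)
    then obtain L where L: "\<And>t. t \<ge> T \<Longrightarrow> \<bar>w t - L\<bar> \<le> - B t" by blast
    have "\<bar>x t - exp (- \<mu> * \<phi> t) * L\<bar> \<le> (C / (p - \<mu>)) * exp (- p * \<phi> t)" if t: "T \<le> t" for t
    proof -
      have "\<bar>x t - exp (- \<mu> * \<phi> t) * L\<bar> = exp (- \<mu> * \<phi> t) * \<bar>w t - L\<bar>"
        by (simp add: xw abs_mult flip: right_diff_distrib)
      also have "\<dots> \<le> exp (- \<mu> * \<phi> t) * (- B t)"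
        by (intro mult_left_mono L t) auto
      also have "\<dots> = (C / (p - \<mu>)) * exp (- p * \<phi> t)"
        using eB[of t] p by (simp add: divide_simps) (simp add: algebra_simps)
      finally show ?thesis .
    qed
    then show ?thesis using False by (intro exI[of _ L] exI[of _ "C / (p - \<mu>)"]) auto
  qed
qed

lemma tendsto_exp_neg_phase:
  fixes \<phi> :: "real \<Rightarrow> real"
  assumes "filterlim \<phi> at_top at_top" "s > 0"
  shows "((\<lambda>t. K * exp (- s * \<phi> t)) \<longlongrightarrow> 0) at_top"
proof -
  have "filterlim (\<lambda>t. s * \<phi> t) at_top at_top"
    by (intro filterlim_tendsto_pos_mult_at_top[OF tendsto_const assms(2) assms(1)])
  then have "((\<lambda>t. exp (- (s * \<phi> t))) \<longlongrightarrow> 0) at_top"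
    by (intro filterlim_compose[OF exp_at_bot] filterlim_compose[OF filterlim_uminus_at_bot_at_top])
  from tendsto_mult_left[OF this, of K] show ?thesis by simp
qed

text \<open>Energy estimate for \<open>N\<close>, the squared norm of \<open>z\<close>. Once
  \<open>z\<close> is small, the perturbation changes \<open>N'\<close> by at most
  \<open>a * q * N\<close>, so \<open>N'\<close> lies between \<open>- (2 * b + a) * q * N\<close>
  and \<open>- a * q * N\<close>. Integrating factors and a square root then give the decay
  exponents \<open>a / 2\<close> and \<open>b + a / 2\<close>.\<close>

lemma exponential_bounds:
  fixes z g :: "real \<Rightarrow> real ^ 'n" and \<phi> q :: "real \<Rightarrow> real" and d :: "real ^ 'n"
  assumes \<phi>: "\<And>t. t \<ge> T \<Longrightarrow> (\<phi> has_real_derivative q t) (at t)"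
    and q: "\<And>t. t \<ge> T \<Longrightarrow> q t > 0"
    and z: "\<And>t i. t \<ge> T \<Longrightarrow>
      ((\<lambda>t. z t $ i) has_real_derivative - q t * d $ i * z t $ i + g t $ i) (at t)"
    and g: "\<And>t. t \<ge> T \<Longrightarrow> norm (g t) \<le> M * q t * norm (z t) powr (1 + \<delta>)"
    and \<delta>: "\<delta> > 0" and M: "M \<ge> 0"
    and z0: "\<And>t. t \<ge> T \<Longrightarrow> z t \<noteq> 0"
    and lim: "(z \<longlongrightarrow> 0) at_top"
    and d: "\<And>i. d $ i > 0"
  shows "\<exists>a>0. \<exists>b>0. \<exists>c>0. \<exists>C T'. \<forall>t\<ge>T'. norm (z t) \<le> C * exp (- a * \<phi> t) \<and> c * exp (- b * \<phi> t)
    \<le> norm (z t)"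
proof -
  define a where "a = Min (range (\<lambda>i. d $ i))"
  define b where "b = Max (range (\<lambda>i. d $ i))"
  have a: "a > 0" "\<And>i. a \<le> d $ i" and b: "\<And>i. d $ i \<le> b"
    using d by (auto simp: a_def b_def)
  define N where "N = (\<lambda>t. z t \<bullet> z t)"
  have "((\<lambda>t. M * norm (z t) powr \<delta>) \<longlongrightarrow> M * 0 powr \<delta>) at_top"
    using \<delta> tendsto_norm_zero[OF lim] by (intro tendsto_intros tendsto_powr') auto
  then have "\<forall>\<^sub>F t in at_top. M * norm (z t) powr \<delta> < a / 2"
    using a(1) \<delta> by (intro order_tendstoD) auto
  then obtain T1 where T1: "\<And>t. t \<ge> T1 \<Longrightarrow> M * norm (z t) powr \<delta> < a / 2"
    by (auto simp: eventually_at_top_linorder)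
  define T' where "T' = max T T1"
  define N' where "N' = (\<lambda>t. 2 * (- q t * (\<Sum>i\<in>UNIV. d $ i * (z t $ i)\<^sup>2) + z t \<bullet> g t))"
  have N': "(N has_real_derivative N' t) (at t)" if "t \<ge> T" for t
  proof -
    have "((\<lambda>t. \<Sum>i\<in>UNIV. z t $ i * z t $ i) has_real_derivative
        (\<Sum>i\<in>UNIV. (- q t * d $ i * z t $ i + g t $ i) * z t $ i + (- q t * d $ i * z t $ i
          + g t $ i) * z t $ i)) (at t)"
      by (intro DERIV_sum DERIV_mult z that)
    also have "(\<Sum>i\<in>UNIV. (- q t * d $ i * z t $ i + g t $ i) * z t $ i + (- q t * d $ i * z t $ i
      + g t $ i) * z t $ i) = N' t"
      by (simp add: N'_def inner_vec_def sum_distrib_left power2_eq_square algebra_simps sum.distrib sum_subtractf sum_negf)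
    finally show ?thesis by (simp add: N_def inner_vec_def)
  qed
  have bounds: "N' t \<le> - a * q t * N t" "N' t \<ge> - (2 * b + a) * q t * N t" if t: "t \<ge> T'" for t
  proof -
    have tT: "t \<ge> T" "t \<ge> T1" using t by (auto simp: T'_def)
    have sq: "N t = (\<Sum>i\<in>UNIV. (z t $ i)\<^sup>2)" by (simp add: N_def inner_vec_def power2_eq_square)
    have 1: "a * N t \<le> (\<Sum>i\<in>UNIV. d $ i * (z t $ i)\<^sup>2)"
      unfolding sq sum_distrib_left by (intro sum_mono mult_right_mono a) auto
    have 2: "(\<Sum>i\<in>UNIV. d $ i * (z t $ i)\<^sup>2) \<le> b * N t"
      unfolding sq sum_distrib_left by (intro sum_mono mult_right_mono b) auto
    have "\<bar>z t \<bullet> g t\<bar> \<le> norm (z t) * norm (g t)" by (rule Cauchy_Schwarz_ineq2)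
    also have "\<dots> \<le> norm (z t) * (M * q t * norm (z t) powr (1 + \<delta>))"
      by (intro mult_left_mono g tT) auto
    also have "\<dots> = q t * N t * (M * norm (z t) powr \<delta>)"
      using z0[OF tT(1)]
        by (simp add: powr_add N_def power2_norm_eq_inner[symmetric] power2_eq_square)
    also have "\<dots> \<le> q t * N t * (a / 2)"
      using q[OF tT(1)] T1[OF tT(2)] by (intro mult_left_mono) (auto simp: N_def)
    finally have 3: "\<bar>z t \<bullet> g t\<bar> \<le> q t * N t * (a / 2)" .
    define P where "P = (\<Sum>i\<in>UNIV. d $ i * (z t $ i)\<^sup>2)"
    have 4: "q t * (a * N t) \<le> q t * P" "q t * P \<le> q t * (b * N t)"
      using 1 2 q[OF tT(1)] by (auto simp: P_def intro!: mult_left_mono)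
    have "N' t = 2 * (- (q t * P) + z t \<bullet> g t)" by (simp add: N'_def P_def)
    then show "N' t \<le> - a * q t * N t" "N' t \<ge> - (2 * b + a) * q t * N t"
      using 3 4 by (auto simp: algebra_simps abs_le_iff)
  qed
  have upper: "exp (a * \<phi> t) * N t \<le> exp (a * \<phi> T') * N T'" if t: "t \<ge> T'" for t
  proof (rule DERIV_nonpos_imp_nonincreasing[OF t])
    fix x assume x: "T' \<le> x" "x \<le> t"
    then have xT: "x \<ge> T" by (auto simp: T'_def)
    have "((\<lambda>t. exp (a * \<phi> t) * N t) has_real_derivative exp (a * \<phi> x) * (N' x
      + a * q x * N x)) (at x)"
      by (rule derivative_eq_intros \<phi> N' xT refl)+ (simp add: algebra_simps)
    moreover have "exp (a * \<phi> x) * (N' x + a * q x * N x) \<le> 0"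
      using bounds(1)[OF x(1)] by (simp add: mult_le_0_iff)
    ultimately show "\<exists>y. ((\<lambda>t. exp (a * \<phi> t) * N t) has_real_derivative y) (at x) \<and> y \<le> 0" by blast
  qed
  have lower: "exp ((2 * b + a) * \<phi> T') * N T' \<le> exp ((2 * b + a) * \<phi> t) * N t" if t: "t \<ge> T'" for t
  proof (rule DERIV_nonneg_imp_nondecreasing[OF t])
    fix x assume x: "T' \<le> x" "x \<le> t"
    then have xT: "x \<ge> T" by (auto simp: T'_def)
    have "((\<lambda>t. exp ((2 * b + a) * \<phi> t) * N t) has_real_derivative exp ((2 * b + a) * \<phi> x) * (N' x
      + (2 * b + a) * q x * N x)) (at x)"
      by (rule derivative_eq_intros \<phi> N' xT refl)+ (simp add: algebra_simps)
    moreover have "exp ((2 * b + a) * \<phi> x) * (N' x + (2 * b + a) * q x * N x) \<ge> 0"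
      using bounds(2)[OF x(1)] by (intro mult_nonneg_nonneg) (auto simp: algebra_simps)
    ultimately show "\<exists>y. ((\<lambda>t. exp ((2 * b + a) * \<phi> t) * N t) has_real_derivative y) (at x) \<and> 0 \<le> y"
      by blast
  qed
  have nN: "norm (z t) = sqrt (N t)" for t by (simp add: N_def norm_eq_sqrt_inner)
  have se: "sqrt (exp x) = exp (x / 2)" for x :: real
    by (rule real_sqrt_unique) (auto simp: power2_eq_square simp flip: exp_add)
  have se': "sqrt (exp ((2 * b + a) * x)) = exp ((b + a / 2) * x)" for x
    unfolding se by (simp add: field_simps)
  have cancel: "exp (- K * \<phi> t) * exp (K * \<phi> t) = 1" for K t
    by (simp flip: exp_add)
  have "norm (z t) \<le> exp (a / 2 * \<phi> T') * norm (z T') * exp (- (a / 2) * \<phi> t)" if t: "t \<ge> T'" for t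
  proof -
    have "exp (a / 2 * \<phi> t) * norm (z t) \<le> exp (a / 2 * \<phi> T') * norm (z T')"
      using real_sqrt_le_mono[OF upper[OF t]] by (simp add: real_sqrt_mult se nN)
    then have "exp (- (a / 2) * \<phi> t) * (exp (a / 2 * \<phi> t) * norm (z t))
      \<le> exp (- (a / 2) * \<phi> t) * (exp (a / 2 * \<phi> T') * norm (z T'))"
      by (rule mult_left_mono) auto
    then show ?thesis by (simp only: mult.assoc[symmetric] cancel mult_1_left) (simp only: ac_simps)
  qed
  moreover have "exp ((b + a / 2) * \<phi> T') * norm (z T') * exp (- (b + a / 2) * \<phi> t)
    \<le> norm (z t)" if t: "t \<ge> T'" for t
  proof -
    have "exp ((b + a / 2) * \<phi> T') * norm (z T') \<le> exp ((b + a / 2) * \<phi> t) * norm (z t)"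
      using real_sqrt_le_mono[OF lower[OF t]] by (simp add: real_sqrt_mult se' nN)
    then have "exp (- (b + a / 2) * \<phi> t) * (exp ((b + a / 2) * \<phi> T') * norm (z T'))
      \<le> exp (- (b + a / 2) * \<phi> t) * (exp ((b + a / 2) * \<phi> t) * norm (z t))"
      by (rule mult_left_mono) auto
    also have "\<dots> = norm (z t)" by (simp only: mult.assoc[symmetric] cancel mult_1_left)
    finally show ?thesis by (simp only: mult.commute)
  qed
  moreover have "exp ((b + a / 2) * \<phi> T') * norm (z T') > 0" using z0[of T'] by (auto simp: T'_def)
  \<comment> \<open>Index types are nonempty, so an arbitrary index, here \<open>undefined\<close>,
    gives \<open>0 < a \<le> d $ i \<le> b\<close>.\<close>
  moreover have "b > 0" using a b[of undefined] a(2)[of undefined] by linarith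
  ultimately show ?thesis using a(1)
    by (intro exI[of _ "a / 2"] exI[of _ "b + a / 2"]
          exI[of _ "exp ((b + a / 2) * \<phi> T') * norm (z T')"]
          exI[of _ "exp (a / 2 * \<phi> T') * norm (z T')"] exI[of _ T'] conjI) auto
qed

text \<open>The upper exponential bound puts a positive exponent into \<Sigma>; the lower one bounds
  \<Sigma> above and forces \<phi> to infinity. The supremum \<Lambda> need not belong to \<Sigma>,
  so all arguments use exponents slightly below it.\<close>

lemma phase_expansion:
  fixes z g :: "real \<Rightarrow> real ^ 'n" and \<phi> q :: "real \<Rightarrow> real" and d :: "real ^ 'n"
  assumes \<phi>: "\<And>t. t \<ge> T \<Longrightarrow> (\<phi> has_real_derivative q t) (at t)"
    and q: "\<And>t. t \<ge> T \<Longrightarrow> q t > 0"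
    and z: "\<And>t i. t \<ge> T \<Longrightarrow>
      ((\<lambda>t. z t $ i) has_real_derivative - q t * d $ i * z t $ i + g t $ i) (at t)"
    and g: "\<And>t. t \<ge> T \<Longrightarrow> norm (g t) \<le> M * q t * norm (z t) powr (1 + \<delta>)"
    and \<delta>: "\<delta> > 0" and M: "M \<ge> 0"
    and z0: "\<And>t. t \<ge> T \<Longrightarrow> z t \<noteq> 0"
    and lim: "(z \<longlongrightarrow> 0) at_top"
    and d: "\<And>i. d $ i > 0"
  shows "filterlim \<phi> at_top at_top"
    and "\<exists>\<Lambda> \<omega> \<epsilon> C T'. \<epsilon> > 0 \<and> \<Lambda> > 0 \<and> \<omega> \<noteq> 0 \<and> (\<forall>i. d $ i \<noteq> \<Lambda> \<longrightarrow> \<omega> $ i = 0) \<and>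
           (\<forall>t\<ge>T'. norm (z t - exp (- \<Lambda> * \<phi> t) *\<^sub>R \<omega>) \<le> C * exp (- (\<Lambda> + \<epsilon>) * \<phi> t))"
proof -
  obtain a b c C1 T1 where a: "a > 0" and b: "b > 0" and c: "c > 0"
    and up: "\<And>t. t \<ge> T1 \<Longrightarrow> norm (z t) \<le> C1 * exp (- a * \<phi> t)"
    and lo: "\<And>t. t \<ge> T1 \<Longrightarrow> c * exp (- b * \<phi> t) \<le> norm (z t)"
    using exponential_bounds[OF \<phi> q z g \<delta> M z0 lim d] by blast
  \<comment> \<open>As \<open>z\<close> tends to 0, so does its lower bound
    \<open>c * exp (- b * \<phi> t)\<close>.\<close>
  show lim\<phi>: "filterlim \<phi> at_top at_top"
    unfolding filterlim_at_top
  proof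
    fix Z :: real
    define e where "e = c * exp (- b * Z)"
    have "\<forall>\<^sub>F t in at_top. norm (z t) < e"
      using order_tendstoD(2)[OF tendsto_norm_zero[OF lim], of e] c by (auto simp: e_def)
    moreover have "\<forall>\<^sub>F t in at_top. t \<ge> T1" by (rule eventually_ge_at_top)
    ultimately show "\<forall>\<^sub>F t in at_top. Z \<le> \<phi> t"
    proof eventually_elim
      case (elim t)
      then have "c * exp (- b * \<phi> t) < c * exp (- b * Z)"
        using lo[of t] by (auto simp: e_def)
      then show ?case using b c by simp
    qed
  qed
  define \<Sigma> where "\<Sigma> = {\<sigma>. \<exists>C. \<forall>\<^sub>F t in at_top. norm (z t) \<le> C * exp (- \<sigma> * \<phi> t)}"
  have \<Sigma>I: "s \<in> \<Sigma>" if "\<And>t. t \<ge> T' \<Longrightarrow> norm (z t) \<le> C * exp (- s * \<phi> t)" for s C T'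
    unfolding \<Sigma>_def mem_Collect_eq eventually_at_top_linorder using that by blast
  have a\<Sigma>: "a \<in> \<Sigma>" using up by (rule \<Sigma>I)
  note exp0 = tendsto_exp_neg_phase[OF lim\<phi>]
  have \<Sigma>b: "\<sigma> \<le> b" if \<sigma>: "\<sigma> \<in> \<Sigma>" for \<sigma>
  proof (rule ccontr)
    assume "\<not> \<sigma> \<le> b"
    obtain C where C: "\<forall>\<^sub>F t in at_top. norm (z t) \<le> C * exp (- \<sigma> * \<phi> t)"
      using \<sigma> unfolding \<Sigma>_def by blast
    \<comment> \<open>An exponent above \<open>b\<close> would push the upper bound for
      \<open>z\<close> below the lower bound \<open>c * exp (- b * \<phi> t)\<close>.\<close>
    have "\<forall>\<^sub>F t in at_top. C * exp (- (\<sigma> - b) * \<phi> t) < c"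
      using \<open>\<not> \<sigma> \<le> b\<close> c by (intro order_tendstoD(2)[OF exp0]) auto
    with C eventually_ge_at_top[of T1] have "\<forall>\<^sub>F t in (at_top :: real filter). False"
    proof eventually_elim
      case (elim t)
      have "c * exp (- b * \<phi> t) \<le> C * exp (- (\<sigma> - b) * \<phi> t) * exp (- b * \<phi> t)"
        using lo[of t] elim by (simp add: algebra_simps flip: exp_add)
      then show False using elim by simp
    qed
    then show False by simp
  qed
  then have bdd: "bdd_above \<Sigma>" by (rule bdd_aboveI)
  define \<Lambda> where "\<Lambda> = Sup \<Sigma>"
  have \<Lambda>0: "\<Lambda> > 0" using cSup_upper[OF a\<Sigma> bdd] a by (simp add: \<Lambda>_def)
  have below: "\<exists>\<sigma>\<in>\<Sigma>. s < \<sigma>" if "s < \<Lambda>" for s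
    using that a\<Sigma> less_cSupD[of \<Sigma> s] by (auto simp: \<Lambda>_def)
  \<comment> \<open>The power \<open>1 + \<delta>\<close> turns decay of \<open>z\<close> with
    exponent \<sigma> into decay of the perturbation with exponent
    \<open>\<sigma> * (1 + \<delta>)\<close>. Choosing \<sigma> close enough to \<Lambda> makes this
    exceed \<Lambda>, which leaves room for \<open>p\<close>.\<close>
  have "\<Lambda> / (1 + \<delta>) < \<Lambda>" using \<Lambda>0 \<delta> by (simp add: field_simps)
  then obtain \<sigma> where \<sigma>: "\<sigma> \<in> \<Sigma>" "\<Lambda> / (1 + \<delta>) < \<sigma>" using below by blast
  then have "\<Lambda> < \<sigma> * (1 + \<delta>)" using \<delta> by (simp add: field_simps)
  with finite_gap_above[of "range (\<lambda>i. d $ i)" \<Lambda> "\<sigma> * (1 + \<delta>)"] obtain p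
    where p: "\<Lambda> < p" "p < \<sigma> * (1 + \<delta>)" "\<And>i. \<Lambda> < d $ i \<Longrightarrow> p < d $ i" by auto
  obtain C2 where C2: "\<forall>\<^sub>F t in at_top. norm (z t) \<le> C2 * exp (- \<sigma> * \<phi> t)"
    using \<sigma> unfolding \<Sigma>_def by blast
  \<comment> \<open>\<open>max C2 0\<close> is visibly nonnegative, as the \<open>powr\<close> rules
    require.\<close>
  define C where "C = M * max C2 0 powr (1 + \<delta>)"
  have C0: "C \<ge> 0" using M by (simp add: C_def)
  have "\<forall>\<^sub>F t in at_top. \<phi> t \<ge> 0 \<and> t \<ge> T \<and> norm (g t) \<le> C * q t * exp (- p * \<phi> t)"
    using C2 eventually_ge_at_top[of T] lim\<phi>[unfolded filterlim_at_top, rule_format, of 0]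
  proof eventually_elim
    case (elim t)
    have "norm (z t) \<le> max C2 0 * exp (- \<sigma> * \<phi> t)"
      by (rule order.trans[OF elim(1)]) (auto intro: mult_right_mono)
    then have "norm (z t) powr (1 + \<delta>) \<le> (max C2 0 * exp (- \<sigma> * \<phi> t)) powr (1 + \<delta>)"
      using \<delta> by (intro powr_mono2) auto
    also have "\<dots> = max C2 0 powr (1 + \<delta>) * exp (- (\<sigma> * (1 + \<delta>)) * \<phi> t)"
      by (subst powr_mult) (auto simp: powr_def algebra_simps)
    also have "\<dots> \<le> max C2 0 powr (1 + \<delta>) * exp (- p * \<phi> t)"
      using p elim by (intro mult_left_mono) (auto intro: mult_right_mono)
    finally have "M * q t * norm (z t) powr (1 + \<delta>)
      \<le> M * q t * (max C2 0 powr (1 + \<delta>) * exp (- p * \<phi> t))"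
      using M q[of t] elim by (intro mult_left_mono) auto
    then show ?case using g[of t] elim by (auto simp: C_def algebra_simps)
  qed
  then obtain T2 where T2: "\<And>t. t \<ge> T2 \<Longrightarrow> \<phi> t \<ge> 0 \<and> t \<ge> T \<and> norm (g t) \<le> C * q t * exp (- p * \<phi> t)"
    by (auto simp: eventually_at_top_linorder)
  have "\<exists>\<omega> K. (d $ i \<noteq> \<Lambda> \<longrightarrow> \<omega> = 0) \<and> (\<forall>t\<ge>T2. \<bar>z t $ i - exp (- \<Lambda> * \<phi> t) * \<omega>\<bar>
    \<le> K * exp (- p * \<phi> t))" for i
  proof -
    have "p \<noteq> d $ i" using p(1) p(3)[of i] by auto
    have "\<exists>\<omega> K. (p < d $ i \<longrightarrow> \<omega> = 0) \<and> (\<forall>t\<ge>T2. \<bar>z t $ i - exp (- (d $ i) * \<phi> t) * \<omega>\<bar>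
      \<le> K * exp (- p * \<phi> t))"
    proof (rule coordinate_expansion[where q = q and g = "\<lambda>t. g t $ i" and C = C])
      fix t assume t: "t \<ge> T2"
      show "\<bar>g t $ i\<bar> \<le> C * q t * exp (- p * \<phi> t)"
        using T2[OF t] component_le_norm_cart[of "g t" i] by linarith
    qed (use T2 \<phi> q z C0 \<open>p \<noteq> d $ i\<close> less_imp_le in blast)+
    then obtain \<omega> K where \<omega>: "p < d $ i \<longrightarrow> \<omega> = 0"
      and K: "\<And>t. t \<ge> T2 \<Longrightarrow> \<bar>z t $ i - exp (- (d $ i) * \<phi> t) * \<omega>\<bar> \<le> K * exp (- p * \<phi> t)" by blast
    \<comment> \<open>Some exponent \<open>s\<close> in \<Sigma> exceeds \<open>d $ i\<close>, so
      \<open>z\<close> decays faster than \<open>exp (- (d $ i) * \<phi> t)\<close>. Dividing by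
      this exponential bounds the constant \<omega> by a function tending to 0.\<close>
    have "\<omega> = 0" if lt: "d $ i < \<Lambda>"
    proof -
      obtain s where s: "s \<in> \<Sigma>" "d $ i < s" using below[OF lt] by blast
      then obtain C3 where C3: "\<forall>\<^sub>F t in at_top. norm (z t) \<le> C3 * exp (- s * \<phi> t)"
        unfolding \<Sigma>_def by blast
      have "((\<lambda>t. C3 * exp (- (s - d $ i) * \<phi> t) + K * exp (- (p - d $ i) * \<phi> t)) \<longlongrightarrow> 0 + 0) at_top"
        using s lt p by (intro tendsto_add exp0) auto
      moreover have "\<forall>\<^sub>F t in at_top. \<bar>\<omega>\<bar>
        \<le> C3 * exp (- (s - d $ i) * \<phi> t) + K * exp (- (p - d $ i) * \<phi> t)"
        using C3 eventually_ge_at_top[of T2]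
      proof eventually_elim
        case (elim t)
        have "exp (- (d $ i) * \<phi> t) * \<bar>\<omega>\<bar> = \<bar>exp (- (d $ i) * \<phi> t) * \<omega>\<bar>" by (simp add: abs_mult)
        also have "\<dots> \<le> \<bar>z t $ i\<bar> + \<bar>z t $ i - exp (- (d $ i) * \<phi> t) * \<omega>\<bar>" by linarith
        also have "\<dots> \<le> C3 * exp (- s * \<phi> t) + K * exp (- p * \<phi> t)"
          using K[of t] elim component_le_norm_cart[of "z t" i] by linarith
        also have "\<dots>
          = exp (- (d $ i) * \<phi> t) * (C3 * exp (- (s - d $ i) * \<phi> t)
            + K * exp (- (p - d $ i) * \<phi> t))"
          by (simp add: algebra_simps flip: exp_add)
        finally show ?case by simp
      qed
      ultimately have "\<bar>\<omega>\<bar> \<le> 0 + 0" by (intro tendsto_lowerbound) auto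
      then show ?thesis by simp
    qed
    then have "d $ i \<noteq> \<Lambda> \<longrightarrow> \<omega> = 0" using \<omega> p(3)[of i] by force
    \<comment> \<open>Unless \<open>d $ i = \<Lambda>\<close>, the coefficient vanishes, so the
      exponential in front of it may be replaced by
      \<open>exp (- \<Lambda> * \<phi> t)\<close>.\<close>
    then show ?thesis using K by (intro exI[of _ \<omega>] exI[of _ K]) (cases "d $ i = \<Lambda>"; auto)
  qed
  then obtain w K where w: "\<And>i. d $ i \<noteq> \<Lambda> \<Longrightarrow> w i = 0"
    and K: "\<And>i t. t \<ge> T2 \<Longrightarrow> \<bar>z t $ i - exp (- \<Lambda> * \<phi> t) * w i\<bar> \<le> K i * exp (- p * \<phi> t)"
    by metis
  define \<omega> where "\<omega> = (\<chi> i. w i)"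
  have est: "norm (z t - exp (- \<Lambda> * \<phi> t) *\<^sub>R \<omega>)
    \<le> (\<Sum>i\<in>UNIV. K i) * exp (- p * \<phi> t)" if "t \<ge> T2" for t
  proof -
    have "norm (z t - exp (- \<Lambda> * \<phi> t) *\<^sub>R \<omega>) \<le> (\<Sum>i\<in>UNIV. \<bar>z t $ i - exp (- \<Lambda> * \<phi> t) * w i\<bar>)"
      using norm_le_l1_cart[of "z t - exp (- \<Lambda> * \<phi> t) *\<^sub>R \<omega>"] by (simp add: \<omega>_def)
    also have "\<dots> \<le> (\<Sum>i\<in>UNIV. K i * exp (- p * \<phi> t))" by (intro sum_mono K that)
    finally show ?thesis by (simp add: sum_distrib_right)
  qed
  \<comment> \<open>Otherwise only the remainder is left and \<open>p > \<Lambda>\<close> would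
    belong to \<Sigma>, against the choice of \<Lambda> as supremum.\<close>
  have "\<omega> \<noteq> 0"
  proof
    assume "\<omega> = 0"
    then have "p \<in> \<Sigma>" using est by (intro \<Sigma>I) auto
    then show False using cSup_upper[OF _ bdd] p(1) by (force simp: \<Lambda>_def)
  qed
  then show "\<exists>\<Lambda> \<omega> \<epsilon> C T'. \<epsilon> > 0 \<and> \<Lambda> > 0 \<and> \<omega> \<noteq> 0 \<and> (\<forall>i. d $ i \<noteq> \<Lambda> \<longrightarrow> \<omega> $ i = 0) \<and>
           (\<forall>t\<ge>T'. norm (z t - exp (- \<Lambda> * \<phi> t) *\<^sub>R \<omega>) \<le> C * exp (- (\<Lambda> + \<epsilon>) * \<phi> t))"
    using est w \<Lambda>0 p(1)
    by (intro exI[of _ \<Lambda>] exI[of _ \<omega>] exI[of _ "p - \<Lambda>"] exI[of _ "\<Sum>i\<in>UNIV. K i"] exI[of _ T2])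
       (auto simp: \<omega>_def)
qed

subsection \<open>Inverting the phase\<close>

text \<open>Near \<open>k\<close> the difference quotient stays within 1 of \<open>D\<close>. The
  bound compares with the fixed point \<open>k\<close> only, not two arbitrary points.\<close>

lemma has_real_derivative_local_Lipschitz:
  fixes f :: "real \<Rightarrow> real"
  assumes "(f has_real_derivative D) (at k)"
  shows "\<exists>L r. L > 0 \<and> r > 0 \<and> (\<forall>x. \<bar>x - k\<bar> < r \<longrightarrow> \<bar>f x - f k\<bar> \<le> L * \<bar>x - k\<bar>)"
proof -
  have "((\<lambda>x. (f x - f k) / (x - k)) \<longlongrightarrow> D) (at k)"
    using assms by (simp add: has_field_derivative_iff)
  then have "\<forall>\<^sub>F x in at k. dist ((f x - f k) / (x - k)) D < 1" by (rule tendstoD) auto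
  then obtain r where r: "r > 0" "\<And>x. x \<noteq> k \<Longrightarrow> dist x k < r \<Longrightarrow> dist ((f x - f k) / (x - k)) D < 1"
    by (auto simp: eventually_at)
  have "\<bar>f x - f k\<bar> \<le> (\<bar>D\<bar> + 1) * \<bar>x - k\<bar>" if "\<bar>x - k\<bar> < r" for x
  proof (cases "x = k")
    case False
    then have "\<bar>(f x - f k) / (x - k)\<bar> \<le> \<bar>D\<bar> + 1" using r(2)[of x] that
      by (simp add: dist_real_def del: abs_divide)
    then show ?thesis using False by (simp add: abs_divide divide_simps)
  qed auto
  then show ?thesis using r(1) by (intro exI[of _ "\<bar>D\<bar> + 1"] exI[of _ r]) auto
qed

lemma powr_local_Lipschitz:
  fixes k p :: real
  assumes "k > 0"
  shows "\<exists>L r. L > 0 \<and> r > 0 \<and> (\<forall>x. \<bar>x - k\<bar> < r \<longrightarrow> \<bar>x powr p - k powr p\<bar> \<le> L * \<bar>x - k\<bar>)"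
  by (rule has_real_derivative_local_Lipschitz) (rule has_real_derivative_powr[OF assms])

text \<open>Up to the factor \<beta>, \<open>q t * exp (\<beta> * \<phi> t)\<close> is the
  derivative of \<open>exp (\<beta> * \<phi> t)\<close>, so \<open>rate\<close> predicts growth like
  \<open>\<beta> * \<eta> * t\<close>, with an error measured in \<phi> rather than in
  \<open>t\<close>. In the application \<open>\<beta> = \<alpha> * \<Lambda>\<close>, and \<eta> is
  the value of \<open>H\<close> at the limiting direction.\<close>

context
  fixes \<phi> q :: "real \<Rightarrow> real" and \<beta> \<eta> \<epsilon> C T :: real
  assumes \<phi>: "\<And>t. t \<ge> T \<Longrightarrow> (\<phi> has_real_derivative q t) (at t)"
    and lim\<phi>: "filterlim \<phi> at_top at_top"
    and rate: "\<And>t. t \<ge> T \<Longrightarrow> \<bar>q t * exp (\<beta> * \<phi> t) - \<eta>\<bar> \<le> C * exp (- \<epsilon> * \<phi> t)"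
    and pos: "\<beta> > 0" "\<eta> > 0" "\<epsilon> > 0"
begin

lemma exp_phase_deriv:
  "t \<ge> T \<Longrightarrow> ((\<lambda>t. exp (\<beta> * \<phi> t) - K * t) has_real_derivative \<beta> * (q t * exp (\<beta> * \<phi> t)) - K) (at t)"
  by (rule derivative_eq_intros \<phi> refl | assumption)+ (simp add: algebra_simps)

text \<open>A crude first bound, by which errors in \<phi> can be expressed in \<open>t\<close>:
  eventually the derivative of \<open>exp (\<beta> * \<phi> t)\<close> is at least half its
  limit.\<close>

lemma exp_phase_ge_linear: "\<exists>c>0. \<exists>T'. \<forall>t\<ge>T'. c * t \<le> exp (\<beta> * \<phi> t)"
proof -
  have "\<forall>\<^sub>F t in at_top. C * exp (- \<epsilon> * \<phi> t) < \<eta> / 2"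
    using pos by (intro order_tendstoD(2)[OF tendsto_exp_neg_phase[OF lim\<phi>]]) auto
  then obtain T1 where T1: "\<And>t. t \<ge> T1 \<Longrightarrow> C * exp (- \<epsilon> * \<phi> t) < \<eta> / 2"
    by (auto simp: eventually_at_top_linorder)
  define T2 where "T2 = max T T1"
  define m where "m = \<beta> * \<eta> / 2"
  have m: "m > 0" using pos by (simp add: m_def)
  \<comment> \<open>Half of the slope \<open>m\<close> is given up to absorb the constant
    \<open>m * T2\<close>, hence the threshold \<open>2 * \<bar>T2\<bar>\<close>.\<close>
  have "m / 2 * t \<le> exp (\<beta> * \<phi> t)" if t: "t \<ge> 2 * \<bar>T2\<bar>" for t
  proof -
    have "exp (\<beta> * \<phi> T2) - m * T2 \<le> exp (\<beta> * \<phi> t) - m * t"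
    proof (rule DERIV_nonneg_imp_nondecreasing[where f = "\<lambda>t. exp (\<beta> * \<phi> t) - m * t"])
      show "T2 \<le> t" using t by linarith
      fix x assume "T2 \<le> x" "x \<le> t"
      then have x: "x \<ge> T" "x \<ge> T1" by (auto simp: T2_def)
      have "q x * exp (\<beta> * \<phi> x) \<ge> \<eta> / 2" using rate[OF x(1)] T1[OF x(2)] by linarith
      then have "\<beta> * (q x * exp (\<beta> * \<phi> x)) - m \<ge> 0"
        using mult_left_mono[of "\<eta> / 2" "q x * exp (\<beta> * \<phi> x)" \<beta>] pos by (simp add: m_def)
      then show "\<exists>y. ((\<lambda>t. exp (\<beta> * \<phi> t) - m * t) has_real_derivative y) (at x) \<and> 0 \<le> y"
        using exp_phase_deriv[OF x(1)] by blast
    qed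
    moreover have "m * (2 * T2) \<le> m * t" using m t by (intro mult_left_mono) auto
    ultimately show ?thesis using exp_gt_zero[of "\<beta> * \<phi> T2"] by linarith
  qed
  then show ?thesis using m by (intro exI[of _ "m / 2"]) auto
qed

text \<open>Raising the linear lower bound to the negative power \<open>- s / \<beta>\<close>
  reverses it.\<close>

lemma exp_neg_phase_le_powr:
  assumes "s > 0"
  shows "\<exists>K T'. \<forall>t\<ge>T'. exp (- s * \<phi> t) \<le> K * t powr (- s / \<beta>)"
proof -
  obtain c T1 where c: "c > 0" and T1: "\<And>t. t \<ge> T1 \<Longrightarrow> c * t \<le> exp (\<beta> * \<phi> t)"
    using exp_phase_ge_linear by blast
  have "exp (- s * \<phi> t) \<le> c powr (- s / \<beta>) * t powr (- s / \<beta>)" if "t \<ge> max T1 1" for t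
  proof -
    have "exp (- s * \<phi> t) = exp (\<beta> * \<phi> t) powr (- s / \<beta>)" using pos by (simp add: powr_def)
    also have "\<dots> \<le> (c * t) powr (- s / \<beta>)"
      using that c T1[of t] assms pos by (intro powr_mono2') (auto simp: divide_simps)
    finally show ?thesis using c that by (simp add: powr_mult)
  qed
  then show ?thesis by blast
qed

text \<open>Bootstrap: with the crude bound the error in \<open>rate\<close> becomes a negative
  power of \<open>t\<close>, and comparison with an antiderivative of that power sharpens the lower
  bound to an asymptotic formula.\<close>

lemma exp_phase_linear:
  "\<exists>K e T'. 0 < e \<and> e < 1 \<and> T' \<ge> 1 \<and> (\<forall>t\<ge>T'. \<bar>exp (\<beta> * \<phi> t) - \<beta> * \<eta> * t\<bar> \<le> K * t powr (1 - e))"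
proof -
  obtain K1 T1 where K1: "\<And>t. t \<ge> T1 \<Longrightarrow> exp (- \<epsilon> * \<phi> t) \<le> K1 * t powr (- \<epsilon> / \<beta>)"
    using exp_neg_phase_le_powr[OF pos(3)] by blast
  \<comment> \<open>The cap keeps \<open>e\<close> below 1, so that \<open>t powr (- e)\<close> has
    the growing antiderivative \<open>t powr (1 - e) / (1 - e)\<close> and no logarithm
    arises.\<close>
  define e where "e = min (\<epsilon> / \<beta>) (1 / 2)"
  define T2 where "T2 = max (max T T1) 1"
  define K where "K = \<beta> * \<bar>C\<bar> * \<bar>K1\<bar>"
  have e: "0 < e" "e < 1" "e \<le> \<epsilon> / \<beta>" using pos by (auto simp: e_def)
  have K0: "K \<ge> 0" using pos by (auto simp: K_def)
  let ?f = "\<lambda>t. exp (\<beta> * \<phi> t) - \<beta> * \<eta> * t"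
  let ?B = "\<lambda>t. K / (1 - e) * t powr (1 - e)"
  have "\<bar>?f t\<bar> \<le> (\<bar>?f T2\<bar> + K / (1 - e)) * t powr (1 - e)" if t: "t \<ge> T2" for t
  proof -
    have "\<bar>?f t - ?f T2\<bar> \<le> ?B t - ?B T2"
    proof (rule abs_increment_le[OF _ _ _ order.refl t])
      fix x assume "x \<ge> T2"
      then have x: "x \<ge> T" "x \<ge> T1" "x \<ge> 1" by (auto simp: T2_def)
      show "(?f has_real_derivative \<beta> * (q x * exp (\<beta> * \<phi> x)) - \<beta> * \<eta>) (at x)"
        by (rule exp_phase_deriv[OF x(1)])
      show "(?B has_real_derivative K * x powr (- e)) (at x)"
        by (rule derivative_eq_intros refl | use x e in \<open>force simp: powr_diff\<close>)+
      have "\<bar>\<beta> * (q x * exp (\<beta> * \<phi> x)) - \<beta> * \<eta>\<bar> = \<beta> * \<bar>q x * exp (\<beta> * \<phi> x) - \<eta>\<bar>"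
        using pos by (simp add: abs_mult flip: right_diff_distrib)
      also have "\<dots> \<le> \<beta> * (\<bar>C\<bar> * exp (- \<epsilon> * \<phi> x))"
      proof (intro mult_left_mono order.trans[OF rate[OF x(1)]])
        show "C * exp (- \<epsilon> * \<phi> x) \<le> \<bar>C\<bar> * exp (- \<epsilon> * \<phi> x)" by (rule mult_right_mono) auto
      qed (use pos in auto)
      also have "exp (- \<epsilon> * \<phi> x) \<le> \<bar>K1\<bar> * x powr (- e)"
      proof -
        have "exp (- \<epsilon> * \<phi> x) \<le> K1 * x powr (- \<epsilon> / \<beta>)" by (rule K1[OF x(2)])
        also have "\<dots> \<le> \<bar>K1\<bar> * x powr (- \<epsilon> / \<beta>)" by (rule mult_right_mono) auto
        also have "\<dots> \<le> \<bar>K1\<bar> * x powr (- e)"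
          using x e by (intro mult_left_mono powr_mono) auto
        finally show ?thesis .
      qed
      finally show "\<bar>\<beta> * (q x * exp (\<beta> * \<phi> x)) - \<beta> * \<eta>\<bar> \<le> K * x powr (- e)"
        using pos by (simp add: K_def mult.assoc mult_left_mono)
    qed
    moreover have "?B T2 \<ge> 0" using K0 e by auto
    moreover have "\<bar>u\<bar> \<le> \<bar>v\<bar> * 1 + w" if "\<bar>u - v\<bar> \<le> w - x" "x \<ge> 0" for u v w x :: real
      using that by linarith
    ultimately have "\<bar>?f t\<bar> \<le> \<bar>?f T2\<bar> * 1 + ?B t" by blast
    \<comment> \<open>For \<open>t \<ge> 1\<close> the initial value is absorbed by the growing
      power.\<close>
    also have "\<dots> \<le> \<bar>?f T2\<bar> * t powr (1 - e) + ?B t"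
      using t e by (intro add_right_mono mult_left_mono ge_one_powr_ge_zero) (auto simp: T2_def)
    finally show ?thesis by (simp add: algebra_simps)
  qed
  moreover have "T2 \<ge> 1" by (simp add: T2_def)
  ultimately show ?thesis using e by blast
qed

text \<open>The quotient \<open>v = exp (\<beta> * \<phi> t) / t\<close> differs from
  \<open>\<beta> * \<eta>\<close> by at most a multiple of \<open>t powr (- e)\<close>. The power
  \<open>- 1 / \<alpha>\<close> is Lipschitz at this positive limit and preserves the rate.\<close>

lemma exp_neg_phase_expansion:
  assumes "\<alpha> > 0"
  shows "\<exists>K e T'. 0 < e \<and> (\<forall>t\<ge>T'. \<bar>exp (- (\<beta> / \<alpha>) * \<phi> t) - (\<beta> * \<eta>) powr (- 1 / \<alpha>) * t powr (- 1 / \<alpha>)\<bar>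
           \<le> K * t powr (- 1 / \<alpha> - e))"
proof -
  obtain K e T1 where e: "0 < e" "e < 1" and T1: "T1 \<ge> 1"
    and K: "\<And>t. t \<ge> T1 \<Longrightarrow> \<bar>exp (\<beta> * \<phi> t) - \<beta> * \<eta> * t\<bar> \<le> K * t powr (1 - e)"
    using exp_phase_linear by blast
  obtain L r where L: "L > 0" "r > 0"
    "\<And>x. \<bar>x - \<beta> * \<eta>\<bar> < r \<Longrightarrow> \<bar>x powr (- 1 / \<alpha>) - (\<beta> * \<eta>) powr (- 1 / \<alpha>)\<bar> \<le> L * \<bar>x - \<beta> * \<eta>\<bar>"
    using powr_local_Lipschitz[of "\<beta> * \<eta>" "- 1 / \<alpha>"] pos by auto
  have "((\<lambda>t. K * t powr (- e)) \<longlongrightarrow> K * 0) at_top"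
    using e by (intro tendsto_mult tendsto_const tendsto_neg_powr filterlim_ident) auto
  then have "\<forall>\<^sub>F t in at_top. K * t powr (- e) < r"
    using L by (intro order_tendstoD(2)[where y = "K * 0"]) auto
  then obtain T2 where T2: "\<And>t. t \<ge> T2 \<Longrightarrow> K * t powr (- e) < r"
    by (auto simp: eventually_at_top_linorder)
  have "\<bar>exp (- (\<beta> / \<alpha>) * \<phi> t) - (\<beta> * \<eta>) powr (- 1 / \<alpha>) * t powr (- 1 / \<alpha>)\<bar>
           \<le> L * K * t powr (- 1 / \<alpha> - e)" if "t \<ge> max T1 T2" for t
  proof -
    have t: "t \<ge> T1" "t \<ge> T2" "t > 0" using that T1 by auto
    define v where "v = exp (\<beta> * \<phi> t) / t"
    have "\<bar>v - \<beta> * \<eta>\<bar> = \<bar>exp (\<beta> * \<phi> t) - \<beta> * \<eta> * t\<bar> / t"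
      using t by (simp add: v_def divide_simps)
    also have "\<dots> \<le> K * t powr (1 - e) / t" by (intro divide_right_mono K t) (use t in auto)
    also have "\<dots> = K * t powr (- e)" using t by (simp add: powr_diff powr_minus divide_simps)
    finally have v: "\<bar>v - \<beta> * \<eta>\<bar> \<le> K * t powr (- e)" .
    have "exp (- (\<beta> / \<alpha>) * \<phi> t) = exp (\<beta> * \<phi> t) powr (- 1 / \<alpha>)" by (simp add: powr_def)
    also have "\<dots> = v powr (- 1 / \<alpha>) * t powr (- 1 / \<alpha>)"
      using t by (simp add: v_def flip: powr_mult)
    finally have "\<bar>exp (- (\<beta> / \<alpha>) * \<phi> t) - (\<beta> * \<eta>) powr (- 1 / \<alpha>) * t powr (- 1 / \<alpha>)\<bar> =
        \<bar>v powr (- 1 / \<alpha>) - (\<beta> * \<eta>) powr (- 1 / \<alpha>)\<bar> * t powr (- 1 / \<alpha>)"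
      by (simp add: abs_mult flip: left_diff_distrib)
    also have "\<dots> \<le> (L * \<bar>v - \<beta> * \<eta>\<bar>) * t powr (- 1 / \<alpha>)"
      using v T2[OF t(2)] by (intro mult_right_mono L) auto
    also have "\<dots> \<le> (L * (K * t powr (- e))) * t powr (- 1 / \<alpha>)"
      using v L by (intro mult_right_mono mult_left_mono) auto
    also have "\<dots> = L * K * t powr (- 1 / \<alpha> - e)"
      using powr_add[of t "- 1 / \<alpha>" "- e"] by simp
    finally show ?thesis .
  qed
  then show ?thesis using e by blast
qed

end

subsection \<open>Homogeneous functions\<close>

lemma pos_homogeneous_polar:
  fixes H :: "real ^ 'n \<Rightarrow> real"
  assumes "pos_homogeneous \<alpha> H" "x \<noteq> 0"
  shows "H x = norm x powr \<alpha> * H (sgn x)"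
proof -
  have "H (norm x *\<^sub>R sgn x) = norm x powr \<alpha> * H (sgn x)"
    using assms unfolding pos_homogeneous_def by simp
  moreover have "norm x *\<^sub>R sgn x = x" using assms by (simp add: sgn_div_norm)
  ultimately show ?thesis by simp
qed

text \<open>In polar form \<open>H\<close> is a radial power times its value at
  \<open>sgn x\<close>. The power is Lipschitz at the norm of \<open>x\<^sub>0\<close>, the
  normalization \<open>sgn\<close> is Lipschitz at \<open>x\<^sub>0\<close>, and (HC) handles the
  sphere.\<close>

lemma homogeneous_Hoelder:
  fixes H :: "real ^ 'n \<Rightarrow> real"
  assumes hom: "pos_homogeneous \<alpha> H" and HC: "property_HC (sphere 0 1) H" and x0: "x\<^sub>0 \<noteq> 0"
  shows "\<exists>r>0. \<exists>C>0. \<exists>\<gamma>>0. \<forall>x. norm (x - x\<^sub>0) < r \<longrightarrow> \<bar>H x - H x\<^sub>0\<bar> \<le> C * norm (x - x\<^sub>0) powr \<gamma>"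
proof -
  define k where "k = norm x\<^sub>0"
  have k: "k > 0" using x0 by (simp add: k_def)
  define u\<^sub>0 where "u\<^sub>0 = sgn x\<^sub>0"
  note polar = pos_homogeneous_polar[OF hom]
  have "u\<^sub>0 \<in> sphere 0 1" using x0 by (simp add: u\<^sub>0_def norm_sgn)
  then obtain r0 C0 \<gamma>0 where r0: "r0 > 0" "C0 > 0" "\<gamma>0 > 0"
    "\<And>u. norm u = 1 \<Longrightarrow> norm (u - u\<^sub>0) < r0 \<Longrightarrow> \<bar>H u - H u\<^sub>0\<bar> \<le> C0 * norm (u - u\<^sub>0) powr \<gamma>0"
    using HC unfolding property_HC_def by (metis mem_sphere_0)
  obtain L r1 where L: "L > 0" "r1 > 0"
    "\<And>x. \<bar>x - k\<bar> < r1 \<Longrightarrow> \<bar>x powr \<alpha> - k powr \<alpha>\<bar> \<le> L * \<bar>x - k\<bar>"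
    using powr_local_Lipschitz[OF k, of \<alpha>] by blast
  \<comment> \<open>The four bounds serve, in order, to compare powers of \<open>e < 1\<close>, to
    keep \<open>x\<close> nonzero, to apply the Lipschitz estimate for the radial power, and to keep
    \<open>sgn x\<close> within \<open>r0\<close> of \<open>u\<^sub>0\<close>. Taking
    \<open>\<gamma> \<le> 1\<close> then lets the Lipschitz error be bounded by
    \<open>e powr \<gamma>\<close> too.\<close>
  define r where "r = Min {1, k, r1, r0 * k / 2}"
  define \<gamma> where "\<gamma> = min \<gamma>0 1"
  define C where "C = (k powr \<alpha> + L) * (C0 * (2 / k) powr \<gamma>0) + L * \<bar>H u\<^sub>0\<bar>"
  have "\<bar>H x - H x\<^sub>0\<bar> \<le> C * norm (x - x\<^sub>0) powr \<gamma>" if x: "norm (x - x\<^sub>0) < r" for x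
  proof -
    define e where "e = norm (x - x\<^sub>0)"
    have e: "e \<ge> 0" "e < 1" "e < k" "e < r1" "e < r0 * k / 2" using x by (auto simp: e_def r_def)
    have x_ne: "x \<noteq> 0" using e(3) by (auto simp: e_def k_def)
    have nx: "\<bar>norm x - k\<bar> \<le> e" unfolding e_def k_def by (rule norm_triangle_ineq3)
    have "(1 / k) *\<^sub>R x = (norm x / k) *\<^sub>R sgn x" using x_ne by (simp add: sgn_div_norm)
    moreover have "(1 / k) *\<^sub>R x\<^sub>0 = u\<^sub>0"
      by (simp add: u\<^sub>0_def sgn_div_norm k_def inverse_eq_divide)
    moreover have "(k - norm x) / k = 1 - norm x / k" using k by (simp add: diff_divide_distrib)
    \<comment> \<open>Each summand has norm at most \<open>e / k\<close>, whence the Lipschitz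
      constant \<open>2 / k\<close>.\<close>
    ultimately have "sgn x - u\<^sub>0 = (1 / k) *\<^sub>R (x - x\<^sub>0) + ((k - norm x) / k) *\<^sub>R sgn x"
      by (simp only: scaleR_diff_right scaleR_diff_left scaleR_one) simp
    then have "norm (sgn x - u\<^sub>0)
      \<le> norm ((1 / k) *\<^sub>R (x - x\<^sub>0)) + norm (((k - norm x) / k) *\<^sub>R sgn x)"
      by (metis norm_triangle_ineq)
    also have "\<dots> = e / k + \<bar>norm x - k\<bar> / k"
      using k x_ne by (simp add: norm_sgn e_def abs_minus_commute)
    also have "\<dots> \<le> 2 / k * e" using nx k by (simp add: field_simps)
    finally have u: "norm (sgn x - u\<^sub>0) \<le> 2 / k * e" .
    also have "\<dots> < r0" using e k by (simp add: field_simps)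
    finally have "\<bar>H (sgn x) - H u\<^sub>0\<bar> \<le> C0 * norm (sgn x - u\<^sub>0) powr \<gamma>0"
      using x_ne by (intro r0) (auto simp: norm_sgn)
    also have "\<dots> \<le> C0 * (2 / k * e) powr \<gamma>0"
      using u r0 by (intro mult_left_mono powr_mono2) auto
    also have "\<dots> = C0 * (2 / k) powr \<gamma>0 * e powr \<gamma>0"
      using k e powr_mult[of "2 / k" e \<gamma>0] by (simp add: mult.assoc)
    also have "\<dots> \<le> C0 * (2 / k) powr \<gamma>0 * e powr \<gamma>"
      using e r0 by (intro mult_left_mono powr_mono') (auto simp: \<gamma>_def)
    finally have 1: "\<bar>H (sgn x) - H u\<^sub>0\<bar> \<le> C0 * (2 / k) powr \<gamma>0 * e powr \<gamma>" .
    have "\<bar>norm x powr \<alpha> - k powr \<alpha>\<bar> \<le> L * \<bar>norm x - k\<bar>" using nx e by (intro L) auto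
    also have "\<dots> \<le> L * e" using nx L by (intro mult_left_mono) auto
    finally have 2: "\<bar>norm x powr \<alpha> - k powr \<alpha>\<bar> \<le> L * e" .
    also have "\<dots> \<le> L * 1" using e L by (intro mult_left_mono) auto
    finally have 3: "norm x powr \<alpha> \<le> k powr \<alpha> + L" by linarith
    have 4: "e \<le> e powr \<gamma>" using powr_mono'[of \<gamma> 1 e] e by (simp add: \<gamma>_def)
    have "H x - H x\<^sub>0 = norm x powr \<alpha> * (H (sgn x) - H u\<^sub>0) + (norm x powr \<alpha> - k powr \<alpha>) * H u\<^sub>0"
      using polar[OF x_ne] polar[OF x0] by (simp add: u\<^sub>0_def k_def algebra_simps)
    then have "\<bar>H x - H x\<^sub>0\<bar>
      \<le> norm x powr \<alpha> * \<bar>H (sgn x) - H u\<^sub>0\<bar> + \<bar>norm x powr \<alpha> - k powr \<alpha>\<bar> * \<bar>H u\<^sub>0\<bar>"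
      by (metis abs_mult abs_of_nonneg abs_triangle_ineq powr_ge_zero)
    also have "\<dots> \<le> (k powr \<alpha> + L) * (C0 * (2 / k) powr \<gamma>0 * e powr \<gamma>) + (L * e powr \<gamma>) * \<bar>H u\<^sub>0\<bar>"
      using 1 2 3 4 L r0 by (intro add_mono mult_mono order.trans[OF 2] mult_left_mono) auto
    also have "\<dots> = C * e powr \<gamma>" by (simp add: C_def algebra_simps)
    finally show ?thesis by (simp add: e_def)
  qed
  moreover have "r > 0" using k r0 L by (simp add: r_def)
  moreover have "C > 0" using k r0 L unfolding C_def by (intro add_pos_nonneg mult_pos_pos) auto
  moreover have "\<gamma> > 0" using r0 by (simp add: \<gamma>_def)
  ultimately show ?thesis by blast
qed

lemma homogeneous_continuous_on:
  fixes H :: "real ^ 'n \<Rightarrow> real"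
  assumes hom: "pos_homogeneous \<alpha> H" and HC: "property_HC (sphere 0 1) H"
  shows "continuous_on (- {0}) H"
proof -
  have "isCont H x\<^sub>0" if x0: "x\<^sub>0 \<noteq> 0" for x\<^sub>0
  proof -
    obtain r C \<gamma> where r: "r > 0" "C > 0" "\<gamma> > 0"
      "\<And>x. norm (x - x\<^sub>0) < r \<Longrightarrow> \<bar>H x - H x\<^sub>0\<bar> \<le> C * norm (x - x\<^sub>0) powr \<gamma>"
      using homogeneous_Hoelder[OF hom HC x0] by blast
    have "((\<lambda>x. H x - H x\<^sub>0) \<longlongrightarrow> 0) (at x\<^sub>0)"
    proof (rule Lim_null_comparison)
      show "\<forall>\<^sub>F x in at x\<^sub>0. norm (H x - H x\<^sub>0) \<le> C * norm (x - x\<^sub>0) powr \<gamma>"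
        using r unfolding eventually_at by (auto simp: dist_norm)
      have "((\<lambda>x. C * norm (x - x\<^sub>0) powr \<gamma>) \<longlongrightarrow> C * norm (x\<^sub>0 - x\<^sub>0) powr \<gamma>) (at x\<^sub>0)"
        using r by (intro tendsto_intros tendsto_powr') auto
      then show "((\<lambda>x. C * norm (x - x\<^sub>0) powr \<gamma>) \<longlongrightarrow> 0) (at x\<^sub>0)" by simp
    qed
    then show ?thesis by (simp add: isCont_def LIM_zero_cancel)
  qed
  then show ?thesis by (intro continuous_at_imp_continuous_on) auto
qed

text \<open>The minimum over the compact sphere is positive, and homogeneity carries it to all
  nonzero points. It lets a factor \<open>norm (y t) powr \<alpha>\<close> be replaced by a multiple
  of the phase speed \<open>H (y t)\<close>.\<close>

lemma homogeneous_lower_bound: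
  fixes H :: "real ^ 'n \<Rightarrow> real"
  assumes hom: "pos_homogeneous \<alpha> H" and HC: "property_HC (sphere 0 1) H"
    and pos: "\<And>x. norm x = 1 \<Longrightarrow> H x > 0"
  shows "\<exists>m>0. \<forall>x. x \<noteq> 0 \<longrightarrow> m * norm x powr \<alpha> \<le> H x"
proof -
  have "continuous_on (sphere 0 1) H"
    by (rule continuous_on_subset[OF homogeneous_continuous_on[OF hom HC]]) auto
  then obtain x\<^sub>0 where x0: "norm x\<^sub>0 = 1" "\<And>x. norm x = 1 \<Longrightarrow> H x\<^sub>0 \<le> H x"
    using continuous_attains_inf[of "sphere (0 :: real ^ 'n) 1" H] by auto
  have "H x\<^sub>0 * norm x powr \<alpha> \<le> H x" if "x \<noteq> 0" for x
  proof -
    have "H x\<^sub>0 \<le> H (sgn x)" using that by (intro x0) (simp add: norm_sgn)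
    then show ?thesis
      using mult_left_mono[of _ _ "norm x powr \<alpha>"] pos_homogeneous_polar[OF hom that]
      by (metis mult.commute powr_ge_zero)
  qed
  then show ?thesis using pos[OF x0(1)] by blast
qed

subsection \<open>Reduction to diagonal form\<close>

lemma diag_matrix_mult_nth: "(diag_matrix f *v v) $ i = f $ i * v $ i"
proof -
  have "(\<Sum>j\<in>UNIV. (if i = j then f $ i else 0) * v $ j) = (\<Sum>j\<in>UNIV. if i
    = j then f $ i * v $ j else 0)"
    by (intro sum.cong) auto
  then show ?thesis by (simp add: diag_matrix_def matrix_vector_mult_def)
qed

lemma
  fixes A :: "real ^ 'n ^ 'n"
  assumes "invertible A"
  shows matrix_inv_right: "A ** matrix_inv A = mat 1"
    and matrix_inv_left: "matrix_inv A ** A = mat 1"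
  using someI_ex[OF assms[unfolded invertible_def]] by (auto simp: matrix_inv_def)

text \<open>Both \<open>A\<close> and its eigenprojections have this form, so each acts diagonally
  on the coordinates \<open>v\<close>.\<close>

lemma conjugated_diag_mult:
  fixes S :: "real ^ 'n ^ 'n"
  assumes "invertible S"
  shows "(matrix_inv S ** diag_matrix f ** S) *v (matrix_inv S *v v)
    = matrix_inv S *v (diag_matrix f *v v)"
proof -
  have "(matrix_inv S ** diag_matrix f ** S) *v (matrix_inv S *v v)
      = matrix_inv S *v (diag_matrix f *v ((S ** matrix_inv S) *v v))"
    by (simp only: matrix_vector_mul_assoc matrix_mul_assoc)
  then show ?thesis by (simp add: matrix_inv_right[OF assms])
qed

lemma antiderivative_at:
  fixes q :: "real \<Rightarrow> real"
  assumes q: "continuous_on {a..} q" and "a < t"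
  shows "((\<lambda>t. integral {a..t} q) has_real_derivative q t) (at t)"
proof -
  have "((\<lambda>t. integral {a..t} q) has_real_derivative q t) (at t within {a..t + 1})"
    using assms by (intro integral_has_real_derivative continuous_on_subset[OF q]) auto
  moreover have "at t within {a..t + 1} = at t"
    using assms by (intro at_within_interior) auto
  ultimately show ?thesis by simp
qed

theorem theorem5p3:
  fixes A S :: "real ^ 'n ^ 'n" and d :: "real ^ 'n"
    and H :: "real ^ 'n \<Rightarrow> real"
    and G :: "real \<Rightarrow> real ^ 'n \<Rightarrow> real ^ 'n"
    and y y' :: "real \<Rightarrow> real ^ 'n"
    and \<alpha> t\<^sub>0 T\<^sub>0 c r \<delta> :: real
  assumes A_diagonalizable: "diagonalized_by A S d"
    and d_pos: "\<And>i. 0 < d $ i"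
    and alpha_pos: "\<alpha> > 0"
    and H_hom: "pos_homogeneous \<alpha> H"
    and H_HC: "property_HC (sphere 0 1) H"
    and H_pos: "\<And>x. norm x = 1 \<Longrightarrow> H x > 0"
    and t0_nonneg: "t\<^sub>0 \<ge> 0"
    and G_cont: "continuous_on ({t\<^sub>0..} \<times> UNIV) (\<lambda>(t, x). G t x)"
    and constants: "T\<^sub>0 \<ge> t\<^sub>0" "c > 0" "r > 0" "\<delta> > 0"
    and G_bound: "\<And>t x. t \<ge> T\<^sub>0 \<Longrightarrow> norm x \<le> r \<Longrightarrow>
                    norm (G t x) \<le> c * norm x powr (1 + \<alpha> + \<delta>)"
    and y_deriv: "\<And>t. t \<ge> t\<^sub>0 \<Longrightarrow> (y has_vector_derivative y' t) (at t within {t\<^sub>0..})"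
    and y'_cont: "continuous_on {t\<^sub>0..} y'"
    and ode: "\<And>t. t > t\<^sub>0 \<Longrightarrow> y' t = - H (y t) *\<^sub>R (A *v y t) + G t (y t)"
    and y_nonzero: "\<And>t. t \<ge> t\<^sub>0 \<Longrightarrow> y t \<noteq> 0"
    and y_lim: "(y \<longlongrightarrow> 0) at_top"
  shows "\<exists>\<Lambda> \<xi>. eigenvalue A \<Lambda> \<and> eigenvector A \<xi> \<Lambda> \<and>
           (\<exists>\<epsilon>>0. (\<lambda>t. norm (y t - t powr (- 1 / \<alpha>) *\<^sub>R \<xi>)) \<in> O(\<lambda>t. t powr (- 1 / \<alpha> - \<epsilon>))) \<and>
           (\<exists>\<epsilon>>0.
              (\<lambda>t. norm ((mat 1 - eigenprojection S d \<Lambda>) *v y t))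
                \<in> O(\<lambda>t. t powr (- 1 / \<alpha> - \<epsilon>)) \<and>
              (\<lambda>t. norm (eigenprojection S d \<Lambda> *v y t - t powr (- 1 / \<alpha>) *\<^sub>R \<xi>))
                \<in> O(\<lambda>t. t powr (- 1 / \<alpha> - \<epsilon>))) \<and>
           \<alpha> * \<Lambda> * H \<xi> = 1"
proof -
  let ?Si = "matrix_inv S"
  have S: "invertible S" and A: "A = ?Si ** diag_matrix d ** S"
    using A_diagonalizable by (auto simp: diagonalized_by_def)
  have SiS: "?Si *v (S *v v) = v" and SSi: "S *v (?Si *v v) = v" for v
    using S by (simp_all add: matrix_vector_mul_assoc matrix_inv_left matrix_inv_right)
  obtain KS where KS: "KS > 0" "\<And>v. norm (S *v v) \<le> KS * norm v"
    using bounded_linear.pos_bounded[OF matrix_vector_mul_bounded_linear[of S]]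
      by (metis mult.commute)
  obtain Ki where Ki: "Ki > 0" "\<And>v. norm (?Si *v v) \<le> Ki * norm v"
    using bounded_linear.pos_bounded[OF matrix_vector_mul_bounded_linear[of ?Si]]
      by (metis mult.commute)
  obtain m where m: "m > 0" "\<And>x. x \<noteq> 0 \<Longrightarrow> m * norm x powr \<alpha> \<le> H x"
    using homogeneous_lower_bound[OF H_hom H_HC H_pos] by blast
  have Hpos: "H x > 0" if "x \<noteq> 0" for x
    using m(2)[OF that] mult_pos_pos[OF m(1), of "norm x powr \<alpha>"] that by simp
  define q where "q = (\<lambda>t. H (y t))"
  define \<phi> where "\<phi> = (\<lambda>t. integral {t\<^sub>0..t} q)"
  have "continuous_on {t\<^sub>0..} y"
    using y_deriv by (auto
      simp: continuous_on_eq_continuous_within intro: has_vector_derivative_continuous)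
  then have "continuous_on {t\<^sub>0..} q"
    unfolding q_def by (rule continuous_on_compose2[OF homogeneous_continuous_on[OF H_hom H_HC]])
      (use y_nonzero in auto)
  then have \<phi>: "(\<phi> has_real_derivative q t) (at t)" if "t > t\<^sub>0" for t
    unfolding \<phi>_def by (rule antiderivative_at) (rule that)
  have q_pos: "q t > 0" if "t \<ge> t\<^sub>0" for t
    using Hpos y_nonzero[OF that] by (simp add: q_def)
  have "\<forall>\<^sub>F t in at_top. norm (y t) < r"
    using order_tendstoD(2)[OF tendsto_norm_zero[OF y_lim]] constants by blast
  then obtain T1 where T1: "\<And>t. t \<ge> T1 \<Longrightarrow> norm (y t) < r"
    by (auto simp: eventually_at_top_linorder)
  define T where "T = Max {T1, T\<^sub>0, t\<^sub>0 + 1}"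
  have T: "T > t\<^sub>0" "T \<ge> T1" "T \<ge> T\<^sub>0" by (auto simp: T_def)
  define z where "z = (\<lambda>t. S *v y t)"
  define g where "g = (\<lambda>t. S *v G t (y t))"
  define M where "M = KS * (c / m * Ki powr (1 + \<delta>))"
  have yz: "y t = ?Si *v z t" for t by (simp add: z_def SiS)
  have z_deriv: "((\<lambda>t. z t $ i) has_real_derivative - q t * d $ i * z t $ i + g t $ i) (at t)"
    if "t \<ge> T" for t i
  proof -
    have t: "t > t\<^sub>0" using that T by simp
    have "(y has_vector_derivative y' t) (at t)"
      using y_deriv[of t] t at_within_interior[of t "{t\<^sub>0..}"] by simp
    from bounded_linear.has_vector_derivative[OF bounded_linear_compose[OF bounded_linear_vec_nth matrix_vector_mul_bounded_linear] this]
    have "((\<lambda>t. z t $ i) has_vector_derivative (S *v y' t) $ i) (at t)"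
      unfolding z_def .
    moreover have "S *v y' t = - q t *\<^sub>R (diag_matrix d *v z t) + g t"
    proof -
      have "A *v y t = ?Si *v (diag_matrix d *v z t)"
        using conjugated_diag_mult[OF S, of d "z t"] by (simp add: A yz)
      then show ?thesis
        by (simp only: ode[OF t] q_def g_def matrix_vector_right_distrib matrix_vector_mult_scaleR SSi)
    qed
    ultimately show ?thesis
      by (simp add: has_real_derivative_iff_has_vector_derivative diag_matrix_mult_nth mult.assoc)
  qed
  have g_bound: "norm (g t) \<le> M * q t * norm (z t) powr (1 + \<delta>)" if "t \<ge> T" for t
  proof -
    have yt: "y t \<noteq> 0" using y_nonzero that T by auto
    have "norm (y t) powr \<alpha> \<le> q t / m" using m(2)[OF yt] m(1) by (simp add: q_def field_simps)
    moreover have "norm (y t) powr (1 + \<delta>) \<le> (Ki * norm (z t)) powr (1 + \<delta>)"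
      using constants Ki(2)[of "z t"] by (intro powr_mono2) (auto simp: yz)
    ultimately have "norm (y t) powr \<alpha> * norm (y t) powr (1 + \<delta>)
      \<le> q t / m * (Ki * norm (z t)) powr (1 + \<delta>)"
      using m q_pos[of t] that T by (intro mult_mono) auto
    then have 1: "norm (y t) powr (1 + \<alpha> + \<delta>)
      \<le> q t / m * (Ki powr (1 + \<delta>) * norm (z t) powr (1 + \<delta>))"
      using Ki by (simp add: powr_mult add.commute add.left_commute flip: powr_add)
    have "norm (g t) \<le> KS * norm (G t (y t))" unfolding g_def by (rule KS)
    also have "\<dots> \<le> KS * (c * norm (y t) powr (1 + \<alpha> + \<delta>))"
      using KS(1) T that T1[of t] by (intro mult_left_mono G_bound) auto
    also have "\<dots> \<le> KS * (c * (q t / m * (Ki powr (1 + \<delta>) * norm (z t) powr (1 + \<delta>))))"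
      using KS(1) constants by (intro mult_left_mono 1) auto
    finally show ?thesis by (simp add: M_def ac_simps)
  qed
  have M0: "M \<ge> 0" using KS Ki m constants by (simp add: M_def)
  have z_ne: "z t \<noteq> 0" if "t \<ge> T" for t
    using y_nonzero[of t] that T yz[of t] by auto
  have z_lim: "(z \<longlongrightarrow> 0) at_top"
    using bounded_linear.tendsto[OF matrix_vector_mul_bounded_linear[of S] y_lim]
      by (simp add: z_def)
  have \<phi>T: "(\<phi> has_real_derivative q t) (at t)" and qT: "q t > 0" if "t \<ge> T" for t
    using \<phi> q_pos that T by auto
  note expansion = phase_expansion[where T
    = T, OF \<phi>T qT z_deriv g_bound constants(4) M0 z_ne z_lim d_pos]
  have lim\<phi>: "filterlim \<phi> at_top at_top" by (rule expansion(1))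
  obtain \<Lambda> \<omega> \<epsilon> C1 T2 where \<Lambda>: "\<epsilon> > 0" "\<Lambda> > 0" "\<omega> \<noteq> 0" "\<And>i. d $ i \<noteq> \<Lambda> \<Longrightarrow> \<omega> $ i = 0"
    and C1: "\<And>t. t \<ge> T2 \<Longrightarrow> norm (z t - exp (- \<Lambda> * \<phi> t) *\<^sub>R \<omega>) \<le> C1 * exp (- (\<Lambda> + \<epsilon>) * \<phi> t)"
    using expansion(2) by blast
  define \<zeta> where "\<zeta> = ?Si *v \<omega>"
  define K2 where "K2 = Ki * \<bar>C1\<bar>"
  have \<zeta>0: "\<zeta> \<noteq> 0" using \<Lambda>(3) SSi[of \<omega>] by (auto simp: \<zeta>_def)
  have y_phase: "norm (y t - exp (- \<Lambda> * \<phi> t) *\<^sub>R \<zeta>)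
    \<le> K2 * exp (- (\<Lambda> + \<epsilon>) * \<phi> t)" if t: "t \<ge> T2" for t
  proof -
    have "y t - exp (- \<Lambda> * \<phi> t) *\<^sub>R \<zeta> = ?Si *v (z t - exp (- \<Lambda> * \<phi> t) *\<^sub>R \<omega>)"
      by (simp only: yz \<zeta>_def matrix_vector_mult_diff_distrib matrix_vector_mult_scaleR)
    then have "norm (y t - exp (- \<Lambda> * \<phi> t) *\<^sub>R \<zeta>) \<le> Ki * norm (z t - exp (- \<Lambda> * \<phi> t) *\<^sub>R \<omega>)"
      using Ki(2) by simp
    also have "\<dots> \<le> Ki * (C1 * exp (- (\<Lambda> + \<epsilon>) * \<phi> t))" using Ki(1)
      by (intro mult_left_mono C1 t) auto
    also have "\<dots> \<le> Ki * (\<bar>C1\<bar> * exp (- (\<Lambda> + \<epsilon>) * \<phi> t))"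
      using Ki(1) by (intro mult_left_mono mult_right_mono) auto
    finally show ?thesis by (simp add: K2_def)
  qed
  define \<beta> where "\<beta> = \<alpha> * \<Lambda>"
  define \<eta> where "\<eta> = H \<zeta>"
  have \<beta>: "\<beta> > 0" and \<eta>: "\<eta> > 0" using \<Lambda> alpha_pos Hpos[OF \<zeta>0] by (auto simp: \<beta>_def \<eta>_def)
  obtain r3 C3 \<gamma> where r3: "r3 > 0" "C3 > 0" "\<gamma> > 0"
    "\<And>x. norm (x - \<zeta>) < r3 \<Longrightarrow> \<bar>H x - \<eta>\<bar> \<le> C3 * norm (x - \<zeta>) powr \<gamma>"
    using homogeneous_Hoelder[OF H_hom H_HC \<zeta>0] unfolding \<eta>_def by blast
  have "\<forall>\<^sub>F t in at_top. K2 * exp (- \<epsilon> * \<phi> t) < r3"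
    using r3 \<Lambda> by (intro order_tendstoD(2)[OF tendsto_exp_neg_phase[OF lim\<phi>]]) auto
  then obtain T3 where T3: "\<And>t. t \<ge> T3 \<Longrightarrow> K2 * exp (- \<epsilon> * \<phi> t) < r3"
    by (auto simp: eventually_at_top_linorder)
  define T4 where "T4 = Max {T, T2, T3}"
  have T4: "T4 \<ge> T" "T4 \<ge> T2" "T4 \<ge> T3" by (auto simp: T4_def)
  have rate: "\<bar>q t * exp (\<beta> * \<phi> t) - \<eta>\<bar>
    \<le> (C3 * K2 powr \<gamma>) * exp (- (\<epsilon> * \<gamma>) * \<phi> t)" if "t \<ge> T4" for t
  proof -
    have t: "t \<ge> T2" "t \<ge> T3" using that T4 by auto
    let ?x = "exp (\<Lambda> * \<phi> t) *\<^sub>R y t"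
    have "H ?x = exp (\<Lambda> * \<phi> t) powr \<alpha> * q t"
      using H_hom by (simp add: pos_homogeneous_def q_def)
    also have "\<dots> = q t * exp (\<beta> * \<phi> t)" by (simp add: powr_def \<beta>_def algebra_simps)
    finally have Hx: "H ?x = q t * exp (\<beta> * \<phi> t)" .
    have "?x - \<zeta> = exp (\<Lambda> * \<phi> t) *\<^sub>R (y t - exp (- \<Lambda> * \<phi> t) *\<^sub>R \<zeta>)"
      by (simp add: scaleR_diff_right flip: exp_add)
    then have "norm (?x - \<zeta>) = exp (\<Lambda> * \<phi> t) * norm (y t - exp (- \<Lambda> * \<phi> t) *\<^sub>R \<zeta>)"
      by simp
    also have "\<dots> \<le> exp (\<Lambda> * \<phi> t) * (K2 * exp (- (\<Lambda> + \<epsilon>) * \<phi> t))"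
      by (intro mult_left_mono y_phase t) auto
    also have "\<dots> = K2 * exp (- \<epsilon> * \<phi> t)" by (simp add: algebra_simps flip: exp_add)
    finally have x: "norm (?x - \<zeta>) \<le> K2 * exp (- \<epsilon> * \<phi> t)" .
    have "\<bar>H ?x - \<eta>\<bar> \<le> C3 * norm (?x - \<zeta>) powr \<gamma>" using x T3[OF t(2)] by (intro r3) auto
    also have "\<dots> \<le> C3 * (K2 * exp (- \<epsilon> * \<phi> t)) powr \<gamma>"
      using x r3 by (intro mult_left_mono powr_mono2) auto
    also have "\<dots> = (C3 * K2 powr \<gamma>) * exp (- (\<epsilon> * \<gamma>) * \<phi> t)"
      using Ki(1) by (simp add: K2_def powr_mult) (simp add: powr_def algebra_simps)
    finally show ?thesis by (simp add: Hx)
  qed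
  have \<phi>4: "(\<phi> has_real_derivative q t) (at t)" if "t \<ge> T4" for t
    using \<phi>T that T4 by auto
  have \<epsilon>\<gamma>: "\<epsilon> * \<gamma> > 0" using \<Lambda> r3 by simp
  define k where "k = (\<beta> * \<eta>) powr (- 1 / \<alpha>)"
  define \<xi> where "\<xi> = k *\<^sub>R \<zeta>"
  have k: "k > 0" using \<beta> \<eta> by (simp add: k_def)
  have "\<beta> / \<alpha> = \<Lambda>" using alpha_pos by (simp add: \<beta>_def)
  with exp_neg_phase_expansion[where T = T4, OF \<phi>4 lim\<phi> rate \<beta> \<eta> \<epsilon>\<gamma> alpha_pos]
  obtain K5 e T5 where e: "e > 0"
    and K5: "\<And>t. t \<ge> T5 \<Longrightarrow> \<bar>exp (- \<Lambda> * \<phi> t) - k * t powr (- 1 / \<alpha>)\<bar> \<le> K5 * t powr (- 1 / \<alpha> - e)"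
    by (auto simp: k_def)
  obtain K6 T6 where K6: "\<And>t. t \<ge> T6 \<Longrightarrow> exp (- (\<Lambda> + \<epsilon>) * \<phi> t) \<le> K6 * t powr (- (\<Lambda> + \<epsilon>) / \<beta>)"
    using exp_neg_phase_le_powr[where T = T4, OF \<phi>4 lim\<phi> rate \<beta> \<eta> \<epsilon>\<gamma>, of "\<Lambda> + \<epsilon>"] \<Lambda> by auto
  define \<epsilon>' where "\<epsilon>' = min e (\<epsilon> / \<beta>)"
  have \<epsilon>': "\<epsilon>' > 0" using e \<Lambda> \<beta> by (simp add: \<epsilon>'_def)
  define T7 where "T7 = Max {T2, T5, T6, 1}"
  define K where "K = K2 * \<bar>K6\<bar> + \<bar>K5\<bar> * norm \<zeta>"
  have y_asymp: "norm (y t - t powr (- 1 / \<alpha>) *\<^sub>R \<xi>) \<le> K * t powr (- 1 / \<alpha> - \<epsilon>')" if "t \<ge> T7" for t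
  proof -
    have t: "t \<ge> T2" "t \<ge> T5" "t \<ge> T6" "t \<ge> 1" using that by (auto simp: T7_def)
    have "K6 * t powr (- (\<Lambda> + \<epsilon>) / \<beta>) \<le> \<bar>K6\<bar> * t powr (- 1 / \<alpha> - \<epsilon>')"
    proof (intro mult_mono powr_mono t)
      have "- (\<Lambda> + \<epsilon>) / \<beta> = - 1 / \<alpha> - \<epsilon> / \<beta>"
        using alpha_pos \<Lambda> by (simp add: \<beta>_def field_simps)
      then show "- (\<Lambda> + \<epsilon>) / \<beta> \<le> - 1 / \<alpha> - \<epsilon>'" by (simp add: \<epsilon>'_def)
    qed auto
    then have 1: "exp (- (\<Lambda> + \<epsilon>) * \<phi> t) \<le> \<bar>K6\<bar> * t powr (- 1 / \<alpha> - \<epsilon>')" using K6[OF t(3)]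
      by linarith
    have "K5 * t powr (- 1 / \<alpha> - e) \<le> \<bar>K5\<bar> * t powr (- 1 / \<alpha> - \<epsilon>')"
      by (intro mult_mono powr_mono t) (auto simp: \<epsilon>'_def)
    then have 2: "\<bar>exp (- \<Lambda> * \<phi> t) - k * t powr (- 1 / \<alpha>)\<bar> \<le> \<bar>K5\<bar> * t powr (- 1 / \<alpha> - \<epsilon>')"
      using K5[OF t(2)] by linarith
    have "y t - t powr (- 1 / \<alpha>) *\<^sub>R \<xi>
      = (y t - exp (- \<Lambda> * \<phi> t) *\<^sub>R \<zeta>) + (exp (- \<Lambda> * \<phi> t) - k * t powr (- 1 / \<alpha>)) *\<^sub>R \<zeta>"
      by (simp add: \<xi>_def algebra_simps)
    then have "norm (y t - t powr (- 1 / \<alpha>) *\<^sub>R \<xi>) \<le> norm (y t - exp (- \<Lambda> * \<phi> t) *\<^sub>R \<zeta>)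
        + \<bar>exp (- \<Lambda> * \<phi> t) - k * t powr (- 1 / \<alpha>)\<bar> * norm \<zeta>"
      by (metis norm_scaleR norm_triangle_ineq)
    also have "\<dots> \<le> K2 * (\<bar>K6\<bar> * t powr (- 1 / \<alpha> - \<epsilon>')) + \<bar>K5\<bar> * t powr (- 1 / \<alpha> - \<epsilon>') * norm \<zeta>"
    proof (intro add_mono mult_right_mono 2)
      have "K2 \<ge> 0" using Ki by (simp add: K2_def)
      then show "norm (y t - exp (- \<Lambda> * \<phi> t) *\<^sub>R \<zeta>) \<le> K2 * (\<bar>K6\<bar> * t powr (- 1 / \<alpha> - \<epsilon>'))"
        using y_phase[OF t(1)] mult_left_mono[OF 1] by (meson order.trans)
    qed auto
    finally show ?thesis by (simp add: K_def algebra_simps)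
  qed
  have asymp: "(\<lambda>t. norm (B *v (y t - t powr (- 1 / \<alpha>) *\<^sub>R \<xi>))) \<in> O(\<lambda>t. t powr (- 1 / \<alpha> - \<epsilon>'))"
    for B :: "real ^ 'n ^ 'n"
  proof -
    obtain KB where KB: "KB > 0" "\<And>v. norm (B *v v) \<le> KB * norm v"
      using bounded_linear.pos_bounded[OF matrix_vector_mul_bounded_linear[of B]]
        by (metis mult.commute)
    have "\<forall>\<^sub>F t in at_top. norm (norm (B *v (y t - t powr (- 1 / \<alpha>) *\<^sub>R \<xi>)))
      \<le> (KB * K) * norm (t powr (- 1 / \<alpha> - \<epsilon>'))"
      using eventually_ge_at_top[of T7]
    proof eventually_elim
      case (elim t)
      have "norm (B *v (y t - t powr (- 1 / \<alpha>) *\<^sub>R \<xi>)) \<le> KB * (K * t powr (- 1 / \<alpha> - \<epsilon>'))"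
        using KB(2) mult_left_mono[OF y_asymp[OF elim], of KB] KB(1)
          by (meson less_imp_le order.trans)
      then show ?case by simp
    qed
    then show ?thesis by (rule bigoI)
  qed
  have "diag_matrix d *v \<omega> = \<Lambda> *\<^sub>R \<omega>"
    using \<Lambda>(4) by (auto simp: vec_eq_iff diag_matrix_mult_nth)
  then have A\<zeta>: "A *v \<zeta> = \<Lambda> *\<^sub>R \<zeta>"
    by (simp add: A \<zeta>_def conjugated_diag_mult[OF S] matrix_vector_mult_scaleR)
  have eigen: "eigenvector A \<xi> \<Lambda>"
    using \<zeta>0 k by (simp add: eigenvector_def \<xi>_def A\<zeta> matrix_vector_mult_scaleR)
  let ?R = "eigenprojection S d \<Lambda>"
  have "diag_matrix (\<chi> i. if d $ i = \<Lambda> then 1 else 0) *v \<omega> = \<omega>"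
    using \<Lambda>(4) by (auto simp: vec_eq_iff diag_matrix_mult_nth)
  then have "?R *v \<zeta> = \<zeta>"
    by (simp add: eigenprojection_def \<zeta>_def conjugated_diag_mult[OF S])
  then have R\<xi>: "?R *v (s *\<^sub>R \<xi>) = s *\<^sub>R \<xi>" for s by (simp add: \<xi>_def matrix_vector_mult_scaleR)
  have "(mat 1 - ?R) *v (y t - s *\<^sub>R \<xi>) = (mat 1 - ?R) *v y t"
    "?R *v (y t - s *\<^sub>R \<xi>) = ?R *v y t - s *\<^sub>R \<xi>" for t s
    by (simp_all add: matrix_vector_mult_diff_rdistrib matrix_vector_mult_diff_distrib R\<xi>)
  then have "(\<lambda>t. norm ((mat 1 - ?R) *v y t)) \<in> O(\<lambda>t. t powr (- 1 / \<alpha> - \<epsilon>'))"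
    "(\<lambda>t. norm (?R *v y t - t powr (- 1 / \<alpha>) *\<^sub>R \<xi>)) \<in> O(\<lambda>t. t powr (- 1 / \<alpha> - \<epsilon>'))"
    using asymp[of "mat 1 - ?R"] asymp[of ?R] by simp_all
  moreover have "(\<lambda>t. norm (y t - t powr (- 1 / \<alpha>) *\<^sub>R \<xi>)) \<in> O(\<lambda>t. t powr (- 1 / \<alpha> - \<epsilon>'))"
    using asymp[of "mat 1"] by simp
  moreover have "\<alpha> * \<Lambda> * H \<xi> = 1"
  proof -
    have "H \<xi> = k powr \<alpha> * \<eta>" using H_hom k by (simp add: pos_homogeneous_def \<xi>_def \<eta>_def)
    also have "k powr \<alpha> = (\<beta> * \<eta>) powr (- 1)"
      unfolding k_def powr_powr using alpha_pos by simp
    also have "\<dots> = inverse (\<beta> * \<eta>)" using \<beta> \<eta> by (subst powr_minus) simp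
    finally show ?thesis using \<beta> \<eta> \<Lambda>(2) alpha_pos by (simp add: \<beta>_def field_simps)
  qed
  ultimately show ?thesis using eigen \<epsilon>' unfolding eigenvalue_def by blast
qed

end
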